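(* Let $A=F(d,d_1,d_2,d_3,h_1,h_2,h_3,g)$ be given, and let $f_A:\mathbb{T}\mathbb{P}^2\to\mathbb{T}\mathbb{P}^2$ be the map $f_A(p)=A\odot p$. Then: 1. for every corner $C$ of the cell decomposition $\mathcal{C}^A$, $f_A$ collapses $\overline{C}$ to a single point, which is a vertex of $\mathcal{T}_A$; 2. $f_A(\overline{P_a})=\overline{a}$ for every antenna $a$ of $\mathcal{T}_A$; 3. for every two-dimensional peripheral cell $P$ of $\mathcal{C}^A$ parallel to a coordinate axis with $P\ne P_a$ for every antenna $a$ of $\mathcal{T}_A$, the restriction $f_A|_{\overline{P}}$ is the classical (parallel) projection onto $\mathcal{T}_A$ in the direction of $P$; 4. $\operatorname{soma}(\mathcal{T}_A)$ is the set of fixed points of $f_A$, and, if $B^A\neq\emptyset$, then $\operatorname{soma}(\mathcal{T}_A)=\overline{B^A}$.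
   Context: $\mathbb{T}=\mathbb{R}\cup\{-\infty\}$ with $a\oplus b=\max\{a,b\}$, $a\odot b=a+b$; matrices are multiplied using $\oplus,\odot$. $\mathbb{T}\mathbb{P}^2$ is the quotient of $\mathbb{T}^3\setminus\{(-\infty,-\infty,-\infty)\}$ by $(p_1,p_2,p_3)\sim(\lambda+p_1,\lambda+p_2,\lambda+p_3)$, $\lambda\in\mathbb{R}$, with the topology induced by the Euclidean one; classes are written $[p_1,p_2,p_3]$ and regarded as columns, and $\overline{S}$ denotes closure in $\mathbb{T}\mathbb{P}^2$. A point $[x,y,z]$ with $z\ne-\infty$ is identified with $(x-z,y-z)$ ("working in $Z=0$"); thus $\mathbb{R}^2\subset\mathbb{T}\mathbb{P}^2$ is the set of points with all coordinates finite. Parameters: $d,d_1,d_2,d_3,h_1,h_2,h_3,g\ge0$ satisfying (subscripts mod 3) condition 1: $h_{j+1}>0$ implies $d_j=0$; condition 2: $g>0$ implies $d=d_1=h_3=0$. Matrices: $$L(d,d_1,d_2,d_3)=\left[\begin{array}{ccc} 0&-d-d_2&-2d-d_3\\ -2d-d_1&0&-d-d_3\\ -d-d_1&-2d-d_2&0 \end{array}\right],$$ $$F(d,d_1,d_2,d_3,h_1,h_2,h_3,g)=\left[\begin{array}{ccc} 0&-d-d_2&-2d-d_3-h_3\\ -2d-d_1-h_1&0&-d-d_3-g\\ -d-d_1&-2d-d_2-h_2&0 \end{array}\right].$$ For a real $3\times3$ matrix $M$, $\mathcal{T}_M\subset\mathbb{T}\mathbb{P}^2$ is the tropical span of its columns: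 all points represented by $\max\{\lambda_1+\operatorname{col}(M,1),\lambda_2+\operatorname{col}(M,2),\lambda_3+\operatorname{col}(M,3)\}$ with $\lambda_j\in\mathbb{T}$ not all $-\infty$. For $A=F(d,\dots,g)$: $\operatorname{soma}(\mathcal{T}_A)=\mathcal{T}_{L(d,d_1,d_2,d_3)}$; the vertices of $\mathcal{T}_A$ meant in part 1 are the points represented by the columns of $A$. Each $h_k>0$ gives an antenna of $\mathcal{T}_A$: in $Z=0$, the classical segment from the point $\operatorname{col}(L(d,d_1,d_2,d_3),k)$ (excluded) to the point $\operatorname{col}(A,k)$ (included); $g>0$ gives the antenna from $\operatorname{col}(L(d,d_1,d_2,d_3),3)$ (excluded) to $\operatorname{col}(A,3)$ (included). Cell decomposition $\mathcal{C}^A$: it is induced by the three tropical lines $A_i=\{p:\max_j(a_{ij}+p_j)\text{ is attained at least twice}\}$, $i=1,2,3$. Its two-dimensional cells are the connected components of $\mathbb{R}^2\setminus(A_1\cup A_2\cup A_3)$, i.e. the nonempty sets of real points $p$ for which, for each $i$, $\max_j(a_{ij}+p_j)$ is attained only at $j=j_i$, for a fixed triple (type) $(j_1,j_2,j_3)$. The corners are the cells of type $(j,j,j)$, $j=1,2,3$. $B^A$ denotes the bounded two-dimensional cell ($B^A=\emptyset$ if there is none). All other two-dimensional cells are peripheral cells parallel to a coordinate axis: exactly one index $k\in\{1,2,3\}$ is missing from the type, the cell is unbounded as $p_k\to-\infty$, and its direction is that of the $k$-th coordinate axis (in $Z=0$: direction $(1,0)$, $(0,1)$, $(1,1)$ for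 $k=1,2,3$). The classical projection onto $\mathcal{T}_A$ in the direction of such $P$ means: for $p\in\overline{P}$, $f_A(p)$ is a point of $\mathcal{T}_A$ which can be obtained from $p$ by changing only the $k$-th coordinate (i.e. it lies on the classical line through $p$ parallel to $P$), and it does not depend on $p_k$. Cell $P_a$: let $a$ be the antenna produced by a positive parameter ($h_1,h_2,h_3$ or $g$) appearing in the entry $(i,k)$ of $A$ (entries $(2,1),(3,2),(1,3),(2,3)$ respectively). Let $a'$ be the classical segment in $Z=0$ from the point $\operatorname{col}(L(d,d_1,d_2,d_3),k)$ to the point $\operatorname{col}(-A^T,i)$ (the corresponding antenna of the triangle co-spanned, with $\min$ in place of $\max$, by the columns of $-A^T$). $P_a$ is the unique two-dimensional peripheral cell of $\mathcal{C}^A$ with $a\cup a'\subset\overline{P_a}$. For example, for the antenna due to $h_2>0$ (so $d_1=0$), $P_a$ is $\{(x,y): d<x,\ 0<y-x-d-d_2<h_2\}$ in $Z=0$, and for the antenna due to $g>0$ it is $\{(x,y): -d_3-g<x<-d_3,\ y<x\}$.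
   Formalization: The formal theorem also assumes that g>0 implies h_1=0; whenever g>0 and h_1>0, part 4 is false, since [0,-m,0] with m=min(h_1,g) is a fixed point of f_A outside soma(T_A). *)

theory Defs
  imports "HOL-Analysis.Analysis"
begin

text \<open>The tropical semiring is the set of all \<^typ>\<open>ereal\<close> values other than \<open>\<infinity>\<close>, with
  maximum as addition and \<open>+\<close> as multiplication.\<close>

definition trop_vecs :: "(ereal ^ 3) set" where
  "trop_vecs = {x. (\<forall>i. x $ i \<noteq> \<infinity>) \<and> (\<exists>i. x $ i \<noteq> - \<infinity>)}"

definition trop_rel :: "ereal ^ 3 \<Rightarrow> ereal ^ 3 \<Rightarrow> bool" where
  "trop_rel x y \<longleftrightarrow> x \<in> trop_vecs \<and> y \<in> trop_vecs \<and> (\<exists>c::real. \<forall>i. x $ i = ereal c + y $ i)"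

quotient_type tp2 = "ereal ^ 3" / partial: trop_rel
proof (rule part_equivpI)
  have "(0 :: ereal ^ 3) \<in> trop_vecs"
    by (simp add: trop_vecs_def)
  then have "trop_rel 0 0"
    unfolding trop_rel_def by (metis add_0 zero_ereal_def)
  then show "\<exists>x. trop_rel x x" ..
  show "symp trop_rel"
  proof (rule sympI)
    fix x y :: "ereal ^ 3"
    assume "trop_rel x y"
    then obtain c :: real where c: "x \<in> trop_vecs" "y \<in> trop_vecs" "\<And>i. x $ i = ereal c + y $ i"
      unfolding trop_rel_def by blast
    have "y $ i = ereal (- c) + x $ i" for i
      unfolding c(3) by (cases "y $ i") auto
    with c(1,2) show "trop_rel y x"
      unfolding trop_rel_def by blast
  qed
  show "transp trop_rel"
  proof (rule transpI)
    fix x y z :: "ereal ^ 3"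
    assume "trop_rel x y" "trop_rel y z"
    then obtain c c' :: real where c: "x \<in> trop_vecs" "z \<in> trop_vecs"
        "\<And>i. x $ i = ereal c + y $ i" "\<And>i. y $ i = ereal c' + z $ i"
      unfolding trop_rel_def by blast
    have "x $ i = ereal (c + c') + z $ i" for i
      unfolding c(3,4) by (cases "z $ i") auto
    with c(1,2) show "trop_rel x z"
      unfolding trop_rel_def by blast
  qed
qed

text \<open>The quotient topology.\<close>

instantiation tp2 :: topological_space
begin

definition open_tp2 :: "tp2 set \<Rightarrow> bool" where
  "open_tp2 U \<longleftrightarrow> openin (top_of_set trop_vecs) {x \<in> trop_vecs. abs_tp2 x \<in> U}"

instance
proof
  show "open (UNIV :: tp2 set)"
    by (simp add: open_tp2_def)
next
  fix S T :: "tp2 set"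
  assume "open S" "open T"
  moreover have "{x \<in> trop_vecs. abs_tp2 x \<in> S \<inter> T}
      = {x \<in> trop_vecs. abs_tp2 x \<in> S} \<inter> {x \<in> trop_vecs. abs_tp2 x \<in> T}"
    by blast
  ultimately show "open (S \<inter> T)"
    unfolding open_tp2_def by (simp only: openin_Int)
next
  fix K :: "tp2 set set"
  assume "\<forall>S\<in>K. open S"
  moreover have "{x \<in> trop_vecs. abs_tp2 x \<in> \<Union>K}
      = \<Union> ((\<lambda>S. {x \<in> trop_vecs. abs_tp2 x \<in> S}) ` K)"
    by blast
  ultimately show "open (\<Union>K)"
    unfolding open_tp2_def by (auto intro!: openin_Union)
qed

end

definition trop_mult :: "real ^ 3 ^ 3 \<Rightarrow> ereal ^ 3 \<Rightarrow> ereal ^ 3" where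
  "trop_mult A x = (\<chi> i. MAX j. ereal (A $ i $ j) + x $ j)"

lemma Max_shift_ereal:
  fixes f :: "3 \<Rightarrow> ereal"
  shows "(MAX j. ereal c + f j) = ereal c + (MAX j. f j)"
proof -
  have "mono (\<lambda>u. ereal c + u)"
    by (simp add: monoI add_left_mono)
  then have "ereal c + Max (range f) = Max ((\<lambda>u. ereal c + u) ` range f)"
    by (rule mono_Max_commute) auto
  then show ?thesis
    by (simp add: image_image)
qed

lemma trop_mult_shift:
  assumes "\<And>i. x $ i = ereal c + y $ i"
  shows "trop_mult A x $ i = ereal c + trop_mult A y $ i"
proof -
  have "trop_mult A x $ i = (MAX j. ereal c + (ereal (A $ i $ j) + y $ j))"
    by (simp only: trop_mult_def vec_lambda_beta assms add.left_commute)
  then show ?thesis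
    by (simp only: Max_shift_ereal trop_mult_def vec_lambda_beta)
qed

lemma trop_mult_in_trop_vecs:
  assumes "x \<in> trop_vecs"
  shows "trop_mult A x \<in> trop_vecs"
proof -
  have "trop_mult A x $ i \<in> range (\<lambda>j. ereal (A $ i $ j) + x $ j)" for i
    unfolding trop_mult_def vec_lambda_beta by (rule Max_in) auto
  moreover have "ereal (A $ i $ j) + x $ j \<noteq> \<infinity>" for i j
    using assms by (simp add: trop_vecs_def)
  ultimately have 1: "trop_mult A x $ i \<noteq> \<infinity>" for i
    by (metis (mono_tags, lifting) imageE)
  obtain j where j: "x $ j \<noteq> - \<infinity>"
    using assms by (auto simp: trop_vecs_def)
  have "ereal (A $ 1 $ j) + x $ j \<le> trop_mult A x $ 1"
    unfolding trop_mult_def by simp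
  with j have "trop_mult A x $ 1 \<noteq> - \<infinity>"
    by (cases "x $ j") auto
  with 1 show ?thesis
    unfolding trop_vecs_def by blast
qed

lift_definition trop_map :: "real ^ 3 ^ 3 \<Rightarrow> tp2 \<Rightarrow> tp2" is trop_mult
proof -
  fix A :: "real ^ 3 ^ 3" and x y :: "ereal ^ 3"
  assume "trop_rel x y"
  then obtain c :: real where c: "x \<in> trop_vecs" "y \<in> trop_vecs" "\<And>i. x $ i = ereal c + y $ i"
    unfolding trop_rel_def by blast
  then show "trop_rel (trop_mult A x) (trop_mult A y)"
    unfolding trop_rel_def using trop_mult_in_trop_vecs trop_mult_shift[OF c(3)] by blast
qed

definition real_point :: "real ^ 3 \<Rightarrow> tp2" where
  "real_point v = abs_tp2 (\<chi> i. ereal (v $ i))"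

definition real_plane :: "tp2 set" where
  "real_plane = range real_point"

text \<open>Passing between homogeneous coordinates and the chart \<open>Z = 0\<close>, on real points.\<close>

definition chart :: "real ^ 3 \<Rightarrow> real \<times> real" where
  "chart v = (v $ 1 - v $ 3, v $ 2 - v $ 3)"

definition of_chart :: "real \<times> real \<Rightarrow> tp2" where
  "of_chart q = real_point (vector [fst q, snd q, 0])"

definition trop_span :: "real ^ 3 ^ 3 \<Rightarrow> tp2 set" where
  "trop_span M = {abs_tp2 (\<chi> i. MAX j. c $ j + ereal (column j M $ i)) |c. c \<in> trop_vecs}"

text \<open>The indices \<open>j\<close> at which the maximum of \<open>A $ i $ j + p $ j\<close> is attained.\<close>

lift_definition maximizers :: "real ^ 3 ^ 3 \<Rightarrow> 3 \<Rightarrow> tp2 \<Rightarrow> 3 set" is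
  "\<lambda>A i x. {j. ereal (A $ i $ j) + x $ j = (MAX k. ereal (A $ i $ k) + x $ k)}"
proof -
  fix A :: "real ^ 3 ^ 3" and i :: 3 and x y :: "ereal ^ 3"
  assume "trop_rel x y"
  then obtain c :: real where c: "\<And>i. x $ i = ereal c + y $ i"
    unfolding trop_rel_def by blast
  have "(ereal (A $ i $ j) + x $ j = trop_mult A x $ i)
      = (ereal (A $ i $ j) + y $ j = trop_mult A y $ i)" for j
    unfolding trop_mult_shift[OF c] c add.left_commute[of _ "ereal c"]
    by (cases "ereal (A $ i $ j) + y $ j"; cases "trop_mult A y $ i") simp_all
  then show "{j. ereal (A $ i $ j) + x $ j = (MAX k. ereal (A $ i $ k) + x $ k)}
      = {j. ereal (A $ i $ j) + y $ j = (MAX k. ereal (A $ i $ k) + y $ k)}"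
    by (simp only: trop_mult_def vec_lambda_beta)
qed

definition trop_line :: "real ^ 3 ^ 3 \<Rightarrow> 3 \<Rightarrow> tp2 set" where
  "trop_line A i = {p. card (maximizers A i p) \<ge> 2}"

definition two_cells :: "real ^ 3 ^ 3 \<Rightarrow> tp2 set set" where
  "two_cells A = components (real_plane - (\<Union>i. trop_line A i))"

definition cell_of_type :: "real ^ 3 ^ 3 \<Rightarrow> (3 \<Rightarrow> 3) \<Rightarrow> tp2 set" where
  "cell_of_type A t = {p \<in> real_plane. \<forall>i. maximizers A i p = {t i}}"

definition corners :: "real ^ 3 ^ 3 \<Rightarrow> tp2 set set" where
  "corners A = {C \<in> two_cells A. \<exists>j. C = cell_of_type A (\<lambda>i. j)}"

text \<open>The index missing from the type is the direction in which the cell is unbounded.\<close>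

definition peripheral_cells :: "real ^ 3 ^ 3 \<Rightarrow> 3 \<Rightarrow> tp2 set set" where
  "peripheral_cells A k = {P \<in> two_cells A. \<exists>t. range t = UNIV - {k} \<and> P = cell_of_type A t}"

definition is_bounded_cell :: "real ^ 3 ^ 3 \<Rightarrow> tp2 set \<Rightarrow> bool" where
  "is_bounded_cell A P \<longleftrightarrow> P \<in> two_cells A \<and> bounded (of_chart -` P)"

definition bounded_cell :: "real ^ 3 ^ 3 \<Rightarrow> tp2 set" where
  "bounded_cell A = (if \<exists>P. is_bounded_cell A P then THE P. is_bounded_cell A P else {})"

text \<open>\<open>q\<close> can be obtained from \<open>p\<close> by changing only the \<open>k\<close>-th homogeneous coordinate, that is,
  both lie on a classical line in the direction of the \<open>k\<close>-th axis.\<close>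

definition agree_off :: "3 \<Rightarrow> tp2 \<Rightarrow> tp2 \<Rightarrow> bool" where
  "agree_off k p q \<longleftrightarrow> (\<exists>x\<in>trop_vecs. \<exists>y\<in>trop_vecs.
     p = abs_tp2 x \<and> q = abs_tp2 y \<and> (\<forall>j. j \<noteq> k \<longrightarrow> x $ j = y $ j))"

definition parallel_projection_on :: "tp2 set \<Rightarrow> 3 \<Rightarrow> tp2 set \<Rightarrow> (tp2 \<Rightarrow> tp2) \<Rightarrow> bool" where
  "parallel_projection_on D k T f \<longleftrightarrow>
     (\<forall>p\<in>D. f p \<in> T \<and> agree_off k p (f p)) \<and>
     (\<forall>p\<in>D. \<forall>q\<in>D. agree_off k p q \<longrightarrow> f p = f q)"

definition matL :: "real \<Rightarrow> real \<Rightarrow> real \<Rightarrow> real \<Rightarrow> real ^ 3 ^ 3" where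
  "matL d d1 d2 d3 = vector [
     vector [0, - d - d2, - 2 * d - d3],
     vector [- 2 * d - d1, 0, - d - d3],
     vector [- d - d1, - 2 * d - d2, 0]]"

definition matF ::
  "real \<Rightarrow> real \<Rightarrow> real \<Rightarrow> real \<Rightarrow> real \<Rightarrow> real \<Rightarrow> real \<Rightarrow> real \<Rightarrow> real ^ 3 ^ 3" where
  "matF d d1 d2 d3 h1 h2 h3 g = vector [
     vector [0, - d - d2, - 2 * d - d3 - h3],
     vector [- 2 * d - d1 - h1, 0, - d - d3 - g],
     vector [- d - d1, - 2 * d - d2 - h2, 0]]"

text \<open>The soma of the span of \<open>matF d d1 d2 d3 h1 h2 h3 g\<close>.\<close>

definition soma :: "real \<Rightarrow> real \<Rightarrow> real \<Rightarrow> real \<Rightarrow> tp2 set" where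
  "soma d d1 d2 d3 = trop_span (matL d d1 d2 d3)"

text \<open>Antennas are indexed by the matrix entry \<open>(i, k)\<close> which contains the positive parameter
  producing them. Below, \<open>L\<close> and \<open>A\<close> stand for the values of \<^const>\<open>matL\<close> and \<^const>\<open>matF\<close>.\<close>

definition antenna_entries :: "real \<Rightarrow> real \<Rightarrow> real \<Rightarrow> real \<Rightarrow> (3 \<times> 3) set" where
  "antenna_entries h1 h2 h3 g =
     {e. e = (2, 1) \<and> h1 > 0 \<or> e = (3, 2) \<and> h2 > 0 \<or> e = (1, 3) \<and> h3 > 0 \<or> e = (2, 3) \<and> g > 0}"

definition antenna :: "real ^ 3 ^ 3 \<Rightarrow> real ^ 3 ^ 3 \<Rightarrow> 3 \<Rightarrow> tp2 set" where
  "antenna L A k = of_chart `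
     (closed_segment (chart (column k L)) (chart (column k A)) - {chart (column k L)})"

definition coantenna :: "real ^ 3 ^ 3 \<Rightarrow> real ^ 3 ^ 3 \<Rightarrow> 3 \<Rightarrow> 3 \<Rightarrow> tp2 set" where
  "coantenna L A i k = of_chart `
     closed_segment (chart (column k L)) (chart (column i (- transpose A)))"

definition antenna_cell :: "real ^ 3 ^ 3 \<Rightarrow> real ^ 3 ^ 3 \<Rightarrow> 3 \<Rightarrow> 3 \<Rightarrow> tp2 set" where
  "antenna_cell L A i k = (THE P. P \<in> (\<Union>j. peripheral_cells A j) \<and>
     antenna L A k \<union> coantenna L A i k \<subseteq> closure P)"

end

theory Submission
  imports Defs
begin

text \<open>Let \<open>A\<close> be the matrix \<open>matF\<close> and \<open>L\<close> the matrix \<open>matL\<close>. All entries of \<open>A\<close> are nonpositive,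
  its diagonal is zero, and everything follows from how far \<open>A\<close> is from being tropically
  idempotent: the conditions on the parameters say that \<open>A \<odot> A = L\<close>, while \<open>L \<odot> L = L\<close>, and
  that \<open>A\<close> and \<open>L\<close> differ exactly in the antenna entries \<open>(i, k)\<close>. There
  \<open>A $ i $ k < L $ i $ k = A $ i $ m + A $ m $ k\<close> for the third index \<open>m\<close>.

  The two-dimensional cells are the nonempty sets of points of a fixed type \<open>t\<close>, and the closure
  of such a cell consists of the points, possibly with infinite coordinates, at which each row
  \<open>i\<close> attains its maximum at \<open>t i\<close>, perhaps not only there (\<open>closure_cell_of_type\<close>). On the
  closure, coordinate \<open>i\<close> of \<open>A \<odot> x\<close> is therefore \<open>A $ i $ t i + x $ t i\<close>, and each part of
  the theorem becomes a matter of finding the possible types.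

  On a corner \<open>t\<close> is constant, and the image is a column of \<open>A\<close>. A cell whose type misses an
  index is unbounded, and a nonempty cell whose type is a permutation has the identity as type,
  so that the closed bounded cell is given by \<open>A \<odot> x \<le> x\<close>. Because the diagonal is zero, this
  says that \<open>x\<close> is fixed. That the fixed points form the span of \<open>L\<close> follows from
  \<open>A \<odot> L \<le> L \<le> A \<odot> A\<close> (\<open>trop_span_eq_fixed_points\<close>).

  For a peripheral cell whose type misses \<open>k\<close>, either \<open>t j = j\<close> for both \<open>j \<noteq> k\<close>, and then the
  map changes coordinate \<open>k\<close> only; or the type is forced, and the inequalities that define the
  cell say that \<open>A\<close> violates the triangle inequality in row \<open>k\<close> (\<open>peripheral_type_cases\<close>). The
  second case occurs at the antenna entries only, and the cell is then \<open>P\<^sub>a\<close>: the outer ends of the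
  antenna and of its dual determine the type (\<open>antenna_data.antenna_type_unique\<close>). On \<open>P\<^sub>a\<close> the
  map is explicit and its image is the closed antenna.\<close>

section \<open>Representatives of points of the tropical projective plane\<close>

lemma trop_rel_self_iff: "trop_rel x x \<longleftrightarrow> x \<in> trop_vecs"
proof -
  have "x $ i = ereal 0 + x $ i" for i
    by (simp flip: zero_ereal_def)
  then show ?thesis
    unfolding trop_rel_def by blast
qed

lemma abs_tp2_eq_iff:
  assumes "x \<in> trop_vecs" "y \<in> trop_vecs"
  shows "abs_tp2 x = abs_tp2 y \<longleftrightarrow> (\<exists>c::real. \<forall>i. x $ i = ereal c + y $ i)"
  using Quotient_rel[OF Quotient_tp2, of x y] assms
  by (simp add: trop_rel_self_iff) (simp add: trop_rel_def)

lemma tp2_cases: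
  obtains x where "x \<in> trop_vecs" "p = abs_tp2 x"
  by (induct p) (auto simp: trop_rel_self_iff)

lemma trop_vecs_not_PInf: "x \<in> trop_vecs \<Longrightarrow> x $ i \<noteq> \<infinity>"
  by (simp add: trop_vecs_def)

definition ereal_vec :: "real ^ 3 \<Rightarrow> ereal ^ 3" where
  "ereal_vec v = (\<chi> i. ereal (v $ i))"

lemma ereal_vec_nth [simp]: "ereal_vec v $ i = ereal (v $ i)"
  by (simp add: ereal_vec_def)

lemma ereal_vec_in_trop_vecs [simp]: "ereal_vec v \<in> trop_vecs"
  by (simp add: trop_vecs_def)

lemma real_point_eq_abs: "real_point v = abs_tp2 (ereal_vec v)"
  by (simp add: real_point_def ereal_vec_def)

lemma ereal_vec_exhaust:
  assumes "x \<in> trop_vecs" "\<And>i. x $ i \<noteq> - \<infinity>"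
  obtains v where "x = ereal_vec v"
proof
  show "x = ereal_vec (\<chi> i. real_of_ereal (x $ i))"
    using assms trop_vecs_not_PInf by (auto simp: vec_eq_iff ereal_real)
qed

lemma real_point_shift: "real_point v = real_point w" if "\<And>i. v $ i = c + w $ i"
  unfolding real_point_eq_abs by (subst abs_tp2_eq_iff) (auto intro!: exI[of _ c] simp: that)

lemma of_chart_chart: "of_chart (chart v) = real_point v"
  unfolding of_chart_def chart_def
proof (rule real_point_shift[of _ "- v $ 3"])
  fix i :: 3
  show "vector [fst (v $ 1 - v $ 3, v $ 2 - v $ 3), snd (v $ 1 - v $ 3, v $ 2 - v $ 3), 0] $ i
      = - v $ 3 + v $ i"
    using exhaust_3[of i] by (auto simp: vector_3)
qed

lemma linear_chart: "linear chart"
  by (rule linearI) (auto simp: chart_def algebra_simps)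

lemma of_chart_segment:
  "of_chart ` closed_segment (chart a) (chart b) = real_point ` closed_segment a b"
  by (simp add: closed_segment_linear_image[OF linear_chart] image_image of_chart_chart)

section \<open>Topology of the tropical projective plane\<close>

lemma closed_tp2I:
  assumes "closed F" "\<And>x. x \<in> trop_vecs \<Longrightarrow> abs_tp2 x \<in> S \<longleftrightarrow> x \<in> F"
  shows "closed S"
proof -
  have "{x \<in> trop_vecs. abs_tp2 x \<in> - S} = trop_vecs \<inter> - F"
    using assms(2) by auto
  moreover have "openin (top_of_set trop_vecs) (trop_vecs \<inter> - F)"
    using assms(1) by (intro openin_open_Int) auto
  ultimately show ?thesis
    unfolding closed_def open_tp2_def by simp
qed

lemma open_tp2I:
  assumes "open U" "\<And>x. x \<in> trop_vecs \<Longrightarrow> abs_tp2 x \<in> S \<longleftrightarrow> x \<in> U"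
  shows "open S"
proof -
  have "{x \<in> trop_vecs. abs_tp2 x \<in> S} = trop_vecs \<inter> U"
    using assms(2) by auto
  then show ?thesis
    unfolding open_tp2_def using assms(1) by (simp add: openin_open_Int)
qed

lemma continuous_on_abs_tp2: "continuous_on trop_vecs abs_tp2"
  unfolding continuous_on_open_invariant
proof (intro allI impI)
  fix B :: "tp2 set"
  assume "open B"
  then obtain T where "open T" "{x \<in> trop_vecs. abs_tp2 x \<in> B} = trop_vecs \<inter> T"
    unfolding open_tp2_def openin_open by blast
  then show "\<exists>A. open A \<and> A \<inter> trop_vecs = abs_tp2 -` B \<inter> trop_vecs"
    by (intro exI[of _ T]) auto
qed

lemma tendsto_abs_tp2:
  assumes "(X \<longlongrightarrow> x) F" "x \<in> trop_vecs" "\<forall>\<^sub>F n in F. X n \<in> trop_vecs"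
  shows "((\<lambda>n. abs_tp2 (X n)) \<longlongrightarrow> abs_tp2 x) F"
  by (rule continuous_on_tendsto_compose[OF continuous_on_abs_tp2 assms])

lemma continuous_on_real_point: "continuous_on UNIV real_point"
proof -
  have "continuous_on UNIV ereal_vec"
    unfolding continuous_on_def
    by (intro ballI vec_tendstoI) (simp add: tendsto_vec_nth)
  then have "continuous_on UNIV (\<lambda>v. abs_tp2 (ereal_vec v))"
    by (rule continuous_on_compose2[OF continuous_on_abs_tp2]) (simp add: image_subset_iff)
  then show ?thesis
    by (simp flip: real_point_eq_abs)
qed

lemma in_closure_limit:
  assumes "(X \<longlongrightarrow> p) F" "\<forall>\<^sub>F n in F. X n \<in> S" "F \<noteq> bot"
  shows "p \<in> closure S"
proof (rule Lim_in_closed_set[OF closed_closure _ assms(3,1)])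
  show "\<forall>\<^sub>F n in F. X n \<in> closure S"
    using assms(2) by (rule eventually_mono) (rule subsetD[OF closure_subset])
qed

lemma continuous_on_shifted_nth: "continuous_on UNIV (\<lambda>x::ereal^3. ereal a + x $ j)"
  unfolding continuous_on_def
  by (intro ballI tendsto_add_ereal_general tendsto_const tendsto_vec_nth tendsto_ident_at) simp

lemma closed_shifted_le: "closed {x::ereal^3. ereal a + x $ j \<le> ereal b + x $ k}"
  by (intro closed_Collect_le continuous_on_shifted_nth)

section \<open>Maximizers\<close>

lemma trop_mult_nth_le_iff:
  "trop_mult A x $ i \<le> y \<longleftrightarrow> (\<forall>j. ereal (A $ i $ j) + x $ j \<le> y)"
  by (simp add: trop_mult_def)

lemma trop_mult_nth_ge: "ereal (A $ i $ j) + x $ j \<le> trop_mult A x $ i"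
  using trop_mult_nth_le_iff by blast

lemma trop_map_abs: "x \<in> trop_vecs \<Longrightarrow> trop_map A (abs_tp2 x) = abs_tp2 (trop_mult A x)"
  by (simp add: trop_map.abs_eq trop_rel_self_iff)

lemma mem_maximizers_iff_trop_mult:
  "x \<in> trop_vecs \<Longrightarrow>
    j \<in> maximizers A i (abs_tp2 x) \<longleftrightarrow> trop_mult A x $ i = ereal (A $ i $ j) + x $ j"
  by (auto simp: maximizers.abs_eq trop_rel_self_iff trop_mult_def)

lemma mem_maximizers_iff:
  "x \<in> trop_vecs \<Longrightarrow> j \<in> maximizers A i (abs_tp2 x) \<longleftrightarrow>
    (\<forall>l. ereal (A $ i $ l) + x $ l \<le> ereal (A $ i $ j) + x $ j)"
  unfolding mem_maximizers_iff_trop_mult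
  by (metis trop_mult_nth_le_iff trop_mult_nth_ge order_antisym order_refl)

lemma maximizers_eq_singleton_iff:
  assumes x: "x \<in> trop_vecs"
  shows "maximizers A i (abs_tp2 x) = {k} \<longleftrightarrow>
    (\<forall>j. j \<noteq> k \<longrightarrow> ereal (A $ i $ j) + x $ j < ereal (A $ i $ k) + x $ k)" (is "?l \<longleftrightarrow> ?r")
proof
  assume l: ?l
  then have "k \<in> maximizers A i (abs_tp2 x)"
    and "\<And>j. j \<noteq> k \<Longrightarrow> j \<notin> maximizers A i (abs_tp2 x)"
    by auto
  then show ?r
    unfolding mem_maximizers_iff[OF x] by (meson not_less order_trans)
next
  assume r: ?r
  then have "k \<in> maximizers A i (abs_tp2 x)"
    unfolding mem_maximizers_iff[OF x] by (metis less_imp_le order_refl)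
  moreover have "j \<notin> maximizers A i (abs_tp2 x)" if "j \<noteq> k" for j
    using r that unfolding mem_maximizers_iff[OF x] by (meson not_le)
  ultimately show ?l
    by blast
qed

lemma mem_maximizers_real_point:
  "j \<in> maximizers A i (real_point v) \<longleftrightarrow> (\<forall>l. A $ i $ l + v $ l \<le> A $ i $ j + v $ j)"
  by (simp add: real_point_eq_abs mem_maximizers_iff)

lemma maximizers_nonempty: "maximizers A i p \<noteq> {}"
proof (cases p rule: tp2_cases)
  case (1 x)
  have "trop_mult A x $ i \<in> range (\<lambda>j. ereal (A $ i $ j) + x $ j)"
    unfolding trop_mult_def vec_lambda_beta by (rule Max_in) auto
  then show ?thesis
    using 1 by (auto simp: mem_maximizers_iff_trop_mult)
qed

lemma not_in_trop_lines_iff: "p \<notin> trop_line A i \<longleftrightarrow> (\<exists>j. maximizers A i p = {j})"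
proof -
  have "card (maximizers A i p) \<noteq> 0"
    using maximizers_nonempty by simp
  then have "p \<notin> trop_line A i \<longleftrightarrow> card (maximizers A i p) = Suc 0"
    unfolding trop_line_def mem_Collect_eq by linarith
  then show ?thesis
    by (simp add: card_1_singleton_iff)
qed

section \<open>Cells are the nonempty sets of points of a fixed type\<close>

definition open_sector :: "real ^ 3 ^ 3 \<Rightarrow> (3 \<Rightarrow> 3) \<Rightarrow> (real ^ 3) set" where
  "open_sector A t =
    {v. \<forall>i j. j \<noteq> t i \<longrightarrow> A $ i $ j + v $ j < A $ i $ t i + v $ t i}"

definition closed_sector :: "real ^ 3 ^ 3 \<Rightarrow> (3 \<Rightarrow> 3) \<Rightarrow> (real ^ 3) set" where
  "closed_sector A t = {v. \<forall>i j. A $ i $ j + v $ j \<le> A $ i $ t i + v $ t i}"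

lemma cell_of_type_eq: "cell_of_type A t = real_point ` open_sector A t"
proof -
  have "(\<forall>i. maximizers A i (real_point v) = {t i}) \<longleftrightarrow> v \<in> open_sector A t" for v
    by (simp add: real_point_eq_abs maximizers_eq_singleton_iff open_sector_def)
  then show ?thesis
    unfolding cell_of_type_def real_plane_def by blast
qed

lemma linear_less_convex: "convex {v::real^3. a + v $ j < b + v $ k}"
proof -
  have "{v::real^3. a + v $ j < b + v $ k} = {v. (axis j 1 - axis k 1) \<bullet> v < b - a}"
    by (auto simp: inner_diff_left inner_axis')
  then show ?thesis
    by (simp add: convex_halfspace_lt)
qed

lemma linear_le_convex: "convex {v::real^3. a + v $ j \<le> b + v $ k}"
proof -
  have "{v::real^3. a + v $ j \<le> b + v $ k} = {v. (axis j 1 - axis k 1) \<bullet> v \<le> b - a}"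
    by (auto simp: inner_diff_left inner_axis')
  then show ?thesis
    by (simp add: convex_halfspace_le)
qed

lemma convex_open_sector: "convex (open_sector A t)"
proof -
  have "open_sector A t =
      (\<Inter>i. \<Inter>j\<in>- {t i}. {v. A $ i $ j + v $ j < A $ i $ t i + v $ t i})"
    by (auto simp: open_sector_def)
  then show ?thesis
    by (simp only:) (intro convex_INT linear_less_convex)
qed

lemma convex_closed_sector: "convex (closed_sector A t)"
proof -
  have "closed_sector A t = (\<Inter>i. \<Inter>j. {v. A $ i $ j + v $ j \<le> A $ i $ t i + v $ t i})"
    by (auto simp: closed_sector_def)
  then show ?thesis
    by (simp only:) (intro convex_INT linear_le_convex)
qed

lemma connected_cell: "connected (cell_of_type A t)"
proof -
  have "continuous_on (open_sector A t) real_point"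
    using continuous_on_real_point by (rule continuous_on_subset) simp
  then show ?thesis
    unfolding cell_of_type_eq
    by (rule connected_continuous_image) (rule convex_connected[OF convex_open_sector])
qed

lemma abs_tp2_in_real_plane_iff:
  assumes "x \<in> trop_vecs"
  shows "abs_tp2 x \<in> real_plane \<longleftrightarrow> (\<forall>i. - \<infinity> < x $ i)"
proof
  assume "abs_tp2 x \<in> real_plane"
  then obtain v where "abs_tp2 x = real_point v"
    unfolding real_plane_def by (rule rangeE)
  then obtain c :: real where "\<And>i. x $ i = ereal c + ereal_vec v $ i"
    unfolding real_point_eq_abs abs_tp2_eq_iff[OF assms ereal_vec_in_trop_vecs] by blast
  then show "\<forall>i. - \<infinity> < x $ i"
    by simp
next
  assume *: "\<forall>i. - \<infinity> < x $ i"
  obtain v where "x = ereal_vec v"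
  proof (rule ereal_vec_exhaust[OF assms])
    show "x $ i \<noteq> - \<infinity>" for i
      using * by (metis less_irrefl)
  qed
  then have "abs_tp2 x = real_point v"
    by (simp add: real_point_eq_abs)
  then show "abs_tp2 x \<in> real_plane"
    by (simp add: real_plane_def)
qed

lemma open_cell: "open (cell_of_type A t)"
proof (rule open_tp2I)
  let ?U = "(\<Inter>i. {x::ereal^3. - \<infinity> < x $ i}) \<inter>
    (\<Inter>i. \<Inter>j\<in>- {t i}. {x. ereal (A $ i $ j) + x $ j < ereal (A $ i $ t i) + x $ t i})"
  show "open ?U"
    by (intro open_Int open_INT finite ballI open_Collect_less continuous_on_shifted_nth
        continuous_on_const continuous_on_id continuous_on_component)
  fix x :: "ereal ^ 3"
  assume x: "x \<in> trop_vecs"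
  show "abs_tp2 x \<in> cell_of_type A t \<longleftrightarrow> x \<in> ?U"
    by (simp add: cell_of_type_def abs_tp2_in_real_plane_iff[OF x]
        maximizers_eq_singleton_iff[OF x]) blast
qed

lemma cell_of_type_unique: "p \<in> cell_of_type A s \<Longrightarrow> p \<in> cell_of_type A t \<Longrightarrow> s = t"
  by (auto simp: cell_of_type_def)

lemma complement_of_trop_lines:
  "real_plane - (\<Union>i. trop_line A i) = (\<Union>t. cell_of_type A t)"
proof (rule set_eqI)
  fix p
  have "p \<in> real_plane - (\<Union>i. trop_line A i) \<longleftrightarrow>
      p \<in> real_plane \<and> (\<exists>t. \<forall>i. maximizers A i p = {t i})"
    by (simp add: not_in_trop_lines_iff choice_iff)
  also have "\<dots> \<longleftrightarrow> p \<in> (\<Union>t. cell_of_type A t)"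
    by (simp add: cell_of_type_def)
  finally show "p \<in> real_plane - (\<Union>i. trop_line A i) \<longleftrightarrow> p \<in> (\<Union>t. cell_of_type A t)" .
qed

text \<open>The sets of points of a fixed type are connected, because they are images of convex sets of
  real vectors, and open. As they partition the complement of the tropical lines, they are its
  components.\<close>

lemma two_cell_eq_cell_of_type:
  assumes "C \<in> two_cells A" "p \<in> C" "p \<in> cell_of_type A t"
  shows "C = cell_of_type A t"
proof
  have C: "C \<in> components (\<Union>t. cell_of_type A t)"
    using assms(1) by (simp add: two_cells_def complement_of_trop_lines)
  show "cell_of_type A t \<subseteq> C"
    by (rule components_maximal[OF C connected_cell]) (use assms in auto)
  let ?V = "\<Union>s\<in>- {t}. cell_of_type A s"
  have "cell_of_type A t \<inter> C = {} \<or> ?V \<inter> C = {}"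
  proof (rule connectedD)
    show "connected C"
      by (rule in_components_connected[OF C])
    show "open (cell_of_type A t)" "open ?V"
      by (auto intro: open_cell)
    show "cell_of_type A t \<inter> ?V \<inter> C = {}"
      using cell_of_type_unique by blast
    show "C \<subseteq> cell_of_type A t \<union> ?V"
      using in_components_subset[OF C] by blast
  qed
  then have V: "?V \<inter> C = {}"
    using assms by blast
  show "C \<subseteq> cell_of_type A t"
  proof
    fix q assume q: "q \<in> C"
    then obtain s where s: "q \<in> cell_of_type A s"
      using in_components_subset[OF C] by blast
    with q V have "s = t"
      by blast
    with s show "q \<in> cell_of_type A t"
      by simp
  qed
qed

lemma two_cells_eq: "two_cells A = range (cell_of_type A) - {{}}"
proof (intro equalityI subsetI)
  fix C assume C: "C \<in> two_cells A"
  then have *: "C \<in> components (\<Union>t. cell_of_type A t)"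
    by (simp only: two_cells_def complement_of_trop_lines)
  then obtain p where "p \<in> C"
    using in_components_nonempty by blast
  then have "C \<noteq> {}" and "p \<in> (\<Union>t. cell_of_type A t)"
    using in_components_subset[OF *] by auto
  then obtain t where "p \<in> cell_of_type A t"
    by blast
  then have "C = cell_of_type A t"
    by (rule two_cell_eq_cell_of_type[OF C \<open>p \<in> C\<close>])
  with \<open>C \<noteq> {}\<close> show "C \<in> range (cell_of_type A) - {{}}"
    by simp
next
  fix C assume "C \<in> range (cell_of_type A) - {{}}"
  then obtain t p where t: "C = cell_of_type A t" "p \<in> cell_of_type A t"
    by auto
  then have "p \<in> \<Union> (two_cells A)"
    unfolding two_cells_def complement_of_trop_lines Union_components by blast
  then obtain D where D: "D \<in> two_cells A" "p \<in> D"
    by blast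
  then have "D = C"
    using two_cell_eq_cell_of_type[of D A p t] t by simp
  with D show "C \<in> two_cells A"
    by simp
qed

text \<open>The strict inequalities that define a cell become weak ones on its closure. Conversely, a
  point \<open>x\<close> satisfying the weak inequalities is a limit of points of the cell: its finite
  coordinates are pushed slightly towards a fixed point \<open>v\<close> of the cell, which makes all
  inequalities between finite coordinates strict, and its coordinates \<open>- \<infinity>\<close> are replaced by
  \<open>- n\<close>. The latter cannot break an inequality for large \<open>n\<close>, because the coordinates whose
  index occurs in the type are finite: they attain a maximum. With this description, \<open>A \<odot> p\<close> is
  an explicit classical affine function of the coordinates of \<open>p\<close> on each closed cell.\<close>

lemma closure_cell_of_type:
  assumes "cell_of_type A t \<noteq> {}"
  shows "closure (cell_of_type A t) = {p. \<forall>i. t i \<in> maximizers A i p}" (is "_ = ?K")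
proof
  have "closed ?K"
  proof (rule closed_tp2I)
    show "closed (\<Inter>i. \<Inter>j. {x::ereal^3.
        ereal (A $ i $ j) + x $ j \<le> ereal (A $ i $ t i) + x $ t i})"
      by (intro closed_INT ballI closed_shifted_le)
  qed (auto simp: mem_maximizers_iff)
  then show "closure (cell_of_type A t) \<subseteq> ?K"
    by (rule closure_minimal[rotated]) (auto simp: cell_of_type_def)
  show "?K \<subseteq> closure (cell_of_type A t)"
  proof
    fix p assume p: "p \<in> ?K"
    obtain x where x: "x \<in> trop_vecs" "p = abs_tp2 x"
      by (rule tp2_cases)
    with p have max: "ereal (A $ i $ j) + x $ j \<le> ereal (A $ i $ t i) + x $ t i" for i j
      by (simp add: mem_maximizers_iff)
    obtain v where v: "v \<in> open_sector A t"
      using assms by (auto simp: cell_of_type_eq)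
    obtain l where l: "x $ l \<noteq> - \<infinity>"
      using x(1) by (auto simp: trop_vecs_def)
    have fin: "x $ t i \<noteq> - \<infinity>" for i
      using max[of i l] l by (cases "x $ l") auto
    define r where "r j = real_of_ereal (x $ j)" for j
    have r: "x $ j = ereal (r j)" if "x $ j \<noteq> - \<infinity>" for j
      using that trop_vecs_not_PInf[OF x(1), of j] by (cases "x $ j") (auto simp: r_def)
    \<comment> \<open>the weight of \<open>v\<close> in the convex combination that approximates \<open>x\<close>\<close>
    define c where "c n = inverse (real (Suc n))" for n
    have c: "c \<longlonglongrightarrow> 0"
      unfolding c_def by (rule LIMSEQ_inverse_real_of_nat)
    have c01: "0 < c n" "c n \<le> 1" for n
      by (auto simp: c_def inverse_le_1_iff)
    define y where
      "y n = (\<chi> j. if x $ j = - \<infinity> then - real n else (1 - c n) * r j + c n * v $ j)" for n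
    have y: "(\<lambda>n. y n $ j) \<longlonglongrightarrow> r j" if "x $ j \<noteq> - \<infinity>" for j
      using that by (auto simp: y_def intro!: tendsto_eq_intros c)
    have "(\<lambda>n. ereal_vec (y n)) \<longlonglongrightarrow> x"
    proof (rule vec_tendstoI)
      fix j
      show "(\<lambda>n. ereal_vec (y n) $ j) \<longlonglongrightarrow> x $ j"
      proof (cases "x $ j = - \<infinity>")
        case True
        have "(\<lambda>n. ereal (- real n)) \<longlonglongrightarrow> - \<infinity>"
          unfolding tendsto_MInfty
        proof (intro allI)
          fix a :: real
          have "\<forall>\<^sub>F n in sequentially. - a < real n"
            using filterlim_real_sequentially unfolding filterlim_at_top_dense by blast
          then show "\<forall>\<^sub>F n in sequentially. ereal (- real n) < ereal a"
            by eventually_elim simp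
        qed
        with True show ?thesis
          by (simp add: y_def)
      next
        case False
        then show ?thesis
          using y[OF False] by (simp add: r[OF False])
      qed
    qed
    then have "(\<lambda>n. real_point (y n)) \<longlonglongrightarrow> p"
      unfolding real_point_eq_abs x(2) using x(1) by (intro tendsto_abs_tp2) auto
    moreover have "\<forall>\<^sub>F n in sequentially. y n \<in> open_sector A t"
    proof -
      have "\<forall>\<^sub>F n in sequentially. j \<noteq> t i \<longrightarrow> A $ i $ j + y n $ j < A $ i $ t i + y n $ t i" for i j
      proof (cases "x $ j = - \<infinity>")
        case True
        have "(\<lambda>n. A $ i $ t i - A $ i $ j + y n $ t i) \<longlonglongrightarrow> A $ i $ t i - A $ i $ j + r (t i)"
          by (rule tendsto_add[OF tendsto_const y[OF fin]])
        then have "filterlim (\<lambda>n. (A $ i $ t i - A $ i $ j + y n $ t i) + real n) at_top sequentially"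
          by (rule filterlim_tendsto_add_at_top[OF _ filterlim_real_sequentially])
        then have "\<forall>\<^sub>F n in sequentially. 0 < (A $ i $ t i - A $ i $ j + y n $ t i) + real n"
          unfolding filterlim_at_top_dense by blast
        then show ?thesis
          by eventually_elim (simp add: y_def True)
      next
        case False
        have *: "A $ i $ j + r j \<le> A $ i $ t i + r (t i)"
          using max[of i j] r[OF False] r[OF fin] by simp
        show ?thesis
        proof (intro always_eventually allI impI)
          fix n assume "j \<noteq> t i"
          with v have "A $ i $ j + v $ j < A $ i $ t i + v $ t i"
            by (auto simp: open_sector_def)
          then have "c n * (A $ i $ j + v $ j) < c n * (A $ i $ t i + v $ t i)"
            using c01 by simp
          moreover have "(1 - c n) * (A $ i $ j + r j) \<le> (1 - c n) * (A $ i $ t i + r (t i))"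
            using c01[of n] * by (intro mult_left_mono) auto
          ultimately show "A $ i $ j + y n $ j < A $ i $ t i + y n $ t i"
            using False fin by (simp add: y_def algebra_simps)
        qed
      qed
      then show ?thesis
        by (simp add: open_sector_def eventually_all_finite)
    qed
    then have "\<forall>\<^sub>F n in sequentially. real_point (y n) \<in> cell_of_type A t"
      by eventually_elim (simp add: cell_of_type_eq)
    ultimately show "p \<in> closure (cell_of_type A t)"
      by (rule in_closure_limit) simp
  qed
qed

section \<open>Corners\<close>

lemma forall_3_distinct:
  fixes i k m :: 3
  assumes "i \<noteq> k" "i \<noteq> m" "k \<noteq> m"
  shows "(\<forall>j. Q j) \<longleftrightarrow> Q i \<and> Q k \<and> Q m"
proof -
  have "j = i \<or> j = k \<or> j = m" for j
    using assms exhaust_3[of i] exhaust_3[of k] exhaust_3[of m] exhaust_3[of j] by auto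
  then show ?thesis
    by metis
qed

lemma third_index:
  fixes i k :: 3
  obtains m where "m \<noteq> i" "m \<noteq> k"
proof -
  have "card {i, k} < CARD(3)"
    using card_insert_le_m1[of 2 "{k}" i] by simp
  then have "{i, k} \<noteq> UNIV"
    by (metis less_irrefl)
  then show ?thesis
    using that by blast
qed

lemma maximizer_not_MInf:
  assumes "x \<in> trop_vecs" "j \<in> maximizers A i (abs_tp2 x)"
  shows "x $ j \<noteq> - \<infinity>"
proof
  assume j: "x $ j = - \<infinity>"
  obtain l where l: "x $ l \<noteq> - \<infinity>"
    using assms(1) by (auto simp: trop_vecs_def)
  have "ereal (A $ i $ l) + x $ l \<le> ereal (A $ i $ j) + x $ j"
    using assms(2) by (simp add: mem_maximizers_iff[OF assms(1)])
  then have "ereal (A $ i $ l) + x $ l \<le> - \<infinity>"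
    by (simp add: j)
  then show False using l by simp
qed
text \<open>On a corner every row attains its maximum at the same index \<open>j\<close>, so that \<open>A \<odot> x\<close> is column
  \<open>j\<close> of \<open>A\<close> shifted by the finite coordinate \<open>x $ j\<close>.\<close>

lemma corner_collapses:
  assumes "C \<in> corners A"
  shows "\<exists>k. trop_map A ` closure C = {real_point (column k A)}"
proof -
  obtain j where C: "C \<in> two_cells A" "C = cell_of_type A (\<lambda>i. j)"
    using assms unfolding corners_def by blast
  from C(1) have ne: "C \<noteq> {}"
    by (simp add: two_cells_eq)
  have const: "trop_map A p = real_point (column j A)" if p: "p \<in> closure C" for p
  proof -
    obtain x where x: "x \<in> trop_vecs" "p = abs_tp2 x"
      by (rule tp2_cases)
    have j: "j \<in> maximizers A i (abs_tp2 x)" for i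
      using p unfolding C(2) x(2) closure_cell_of_type[OF ne[unfolded C(2)]] by simp
    obtain c where c: "x $ j = ereal c"
      using maximizer_not_MInf[OF x(1) j] trop_vecs_not_PInf[OF x(1), of j] by (cases "x $ j") simp_all
    have "trop_mult A x $ i = ereal c + ereal_vec (column j A) $ i" for i
      using j[of i] c by (simp add: mem_maximizers_iff_trop_mult[OF x(1)] column_def)
    then show ?thesis
      unfolding x(2) trop_map_abs[OF x(1)] real_point_eq_abs
        abs_tp2_eq_iff[OF trop_mult_in_trop_vecs[OF x(1)] ereal_vec_in_trop_vecs] by blast
  qed
  have "trop_map A ` closure C = (\<lambda>_. real_point (column j A)) ` closure C"
    by (rule image_cong) (simp_all add: const)
  also have "\<dots> = {real_point (column j A)}"
    using ne by (simp add: image_constant_conv)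
  finally show ?thesis
    by blast
qed

section \<open>Fixed points and the bounded cell\<close>

text \<open>A projective fixed point satisfies \<open>A \<odot> x = c \<odot> x\<close>. The eigenvalue \<open>c\<close> must be \<open>0\<close>: at the
  largest coordinate of \<open>x\<close> the zero diagonal gives \<open>c \<ge> 0\<close>, and the nonpositive entries give
  \<open>c \<le> 0\<close>.\<close>

lemma trop_map_fixed_iff:
  assumes diag: "\<And>i. A $ i $ i = 0" and nonpos: "\<And>i j. A $ i $ j \<le> 0"
    and x: "x \<in> trop_vecs"
  shows "trop_map A (abs_tp2 x) = abs_tp2 x \<longleftrightarrow> trop_mult A x = x"
proof
  assume "trop_map A (abs_tp2 x) = abs_tp2 x"
  then obtain c :: real where c: "\<And>i. trop_mult A x $ i = ereal c + x $ i"
    unfolding trop_map_abs[OF x] abs_tp2_eq_iff[OF trop_mult_in_trop_vecs[OF x] x] by blast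
  obtain k where k: "\<And>j. x $ j \<le> x $ k"
  proof -
    have "Max (range (\<lambda>j. x $ j)) \<in> range (\<lambda>j. x $ j)"
      by (rule Max_in) auto
    then obtain k where "Max (range (\<lambda>j. x $ j)) = x $ k"
      by (rule rangeE)
    then show ?thesis
      by (intro that[of k]) (metis Max_ge finite finite_imageI rangeI)
  qed
  obtain l where "x $ l \<noteq> - \<infinity>"
    using x by (auto simp: trop_vecs_def)
  with k[of l] trop_vecs_not_PInf[OF x, of k] obtain r where r: "x $ k = ereal r"
    by (cases "x $ k") auto
  have "x $ k \<le> trop_mult A x $ k"
    using trop_mult_nth_ge[of A k k x] diag[of k] by (simp add: zero_ereal_def[symmetric])
  moreover have "trop_mult A x $ k \<le> x $ k"
    unfolding trop_mult_nth_le_iff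
  proof
    fix j
    have "ereal (A $ k $ j) + x $ j \<le> 0 + x $ k"
      using nonpos[of k j] k[of j] by (intro add_mono) auto
    then show "ereal (A $ k $ j) + x $ j \<le> x $ k"
      by simp
  qed
  ultimately have "c = 0"
    unfolding c r by simp
  then show "trop_mult A x = x"
    using c by (simp add: vec_eq_iff zero_ereal_def[symmetric])
qed (simp add: trop_map_abs[OF x])

lemma trop_mult_fixed_iff_maximizers:
  assumes "\<And>i. A $ i $ i = 0" "x \<in> trop_vecs"
  shows "trop_mult A x = x \<longleftrightarrow> (\<forall>i. i \<in> maximizers A i (abs_tp2 x))"
  by (simp add: mem_maximizers_iff_trop_mult[OF assms(2)] assms(1) vec_eq_iff
      zero_ereal_def[symmetric])

lemma trop_span_eq_range: "trop_span M = range (trop_map M)"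
proof -
  have "(\<chi> i. MAX j. c $ j + ereal (column j M $ i)) = trop_mult M c" for c
    by (simp add: trop_mult_def column_def add.commute)
  then have "trop_span M = {abs_tp2 (trop_mult M c) |c. c \<in> trop_vecs}"
    by (simp add: trop_span_def)
  also have "\<dots> = range (trop_map M)"
  proof (intro equalityI subsetI)
    fix p assume "p \<in> range (trop_map M)"
    then obtain q where q: "p = trop_map M q"
      by blast
    obtain x where "x \<in> trop_vecs" "q = abs_tp2 x"
      by (rule tp2_cases)
    with q show "p \<in> {abs_tp2 (trop_mult M c) |c. c \<in> trop_vecs}"
      using trop_map_abs by auto
  qed (auto simp: trop_map_abs[symmetric])
  finally show ?thesis .
qed

text \<open>The hypotheses say that \<open>A \<odot> L \<le> L \<le> A \<odot> A\<close> entrywise, so \<open>L\<close> plays the role of the Kleene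
  star of \<open>A\<close>. For \<open>x = L \<odot> c\<close> this gives \<open>x \<le> A \<odot> x \<le> x\<close>, and for \<open>A \<odot> x = x\<close> it gives
  \<open>x \<le> L \<odot> x \<le> A \<odot> (A \<odot> x) = x\<close>.\<close>

lemma trop_span_eq_fixed_points:
  assumes diag: "\<And>i. A $ i $ i = 0" and nonpos: "\<And>i j. A $ i $ j \<le> 0"
    and diagL: "\<And>i. L $ i $ i = 0"
    and AL: "\<And>i j k. A $ i $ j + L $ j $ k \<le> L $ i $ k"
    and AA: "\<And>i k. \<exists>j. L $ i $ k \<le> A $ i $ j + A $ j $ k"
  shows "trop_span L = {p. trop_map A p = p}"
proof (intro equalityI subsetI)
  fix p assume "p \<in> trop_span L"
  then obtain q where q: "p = trop_map L q"
    unfolding trop_span_eq_range by blast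
  obtain c where c: "c \<in> trop_vecs" "q = abs_tp2 c"
    by (rule tp2_cases)
  let ?x = "trop_mult L c"
  have x: "?x \<in> trop_vecs"
    by (rule trop_mult_in_trop_vecs[OF c(1)])
  have "ereal (A $ i $ j) + ?x $ j \<le> ?x $ i" for i j
  proof -
    obtain k where k: "k \<in> maximizers L j (abs_tp2 c)"
      using maximizers_nonempty by blast
    then have "ereal (A $ i $ j) + ?x $ j = ereal (A $ i $ j + L $ j $ k) + c $ k"
      by (simp add: mem_maximizers_iff_trop_mult[OF c(1)] add.assoc flip: plus_ereal.simps)
    also have "\<dots> \<le> ereal (L $ i $ k) + c $ k"
      using AL by (intro add_right_mono) simp
    also have "\<dots> \<le> ?x $ i"
      by (rule trop_mult_nth_ge)
    finally show ?thesis .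
  qed
  then have "trop_mult A ?x = ?x"
    unfolding trop_mult_fixed_iff_maximizers[OF diag x] mem_maximizers_iff[OF x]
    by (simp add: diag flip: zero_ereal_def)
  then have "trop_map A (abs_tp2 ?x) = abs_tp2 ?x"
    by (simp add: trop_map_abs[OF x])
  then show "p \<in> {p. trop_map A p = p}"
    by (simp add: q c(2) trop_map_abs[OF c(1)])
next
  fix p assume p: "p \<in> {p. trop_map A p = p}"
  obtain x where x: "x \<in> trop_vecs" "p = abs_tp2 x"
    by (rule tp2_cases)
  have fixed: "trop_mult A x = x"
    using p trop_map_fixed_iff[OF diag nonpos x(1)] by (simp add: x(2))
  then have A: "ereal (A $ i $ j) + x $ j \<le> x $ i" for i j
    using trop_mult_nth_ge[of A i j x] fixed by simp
  have "trop_mult L x $ i = x $ i" for i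
  proof (rule antisym)
    show "trop_mult L x $ i \<le> x $ i"
      unfolding trop_mult_nth_le_iff
    proof
      fix k
      obtain j where j: "L $ i $ k \<le> A $ i $ j + A $ j $ k"
        using AA by blast
      then have "ereal (L $ i $ k) + x $ k \<le> ereal (A $ i $ j + A $ j $ k) + x $ k"
        by (intro add_right_mono) simp
      also have "\<dots> = ereal (A $ i $ j) + (ereal (A $ j $ k) + x $ k)"
        by (simp add: add.assoc flip: plus_ereal.simps)
      also have "\<dots> \<le> ereal (A $ i $ j) + x $ j"
        by (intro add_left_mono A)
      also have "\<dots> \<le> x $ i"
        by (rule A)
      finally show "ereal (L $ i $ k) + x $ k \<le> x $ i" .
    qed
    show "x $ i \<le> trop_mult L x $ i"
      using trop_mult_nth_ge[of L i i x] diagL[of i] by (simp flip: zero_ereal_def)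
  qed
  then have "trop_mult L x = x"
    by (simp add: vec_eq_iff)
  then show "p \<in> trop_span L"
    unfolding trop_span_eq_range x(2) by (metis trop_map_abs[OF x(1)] rangeI)
qed

lemma chart_axis_nonzero: "chart (axis k 1) \<noteq> 0"
  using exhaust_3[of k] by (auto simp: chart_def axis_def prod_eq_iff)

text \<open>If \<open>k\<close> does not occur in the type, coordinate \<open>k\<close> attains no maximum and may decrease without
  leaving the cell.\<close>

lemma unbounded_cell:
  assumes "k \<notin> range t" "cell_of_type A t \<noteq> {}"
  shows "\<not> bounded (of_chart -` cell_of_type A t)"
proof
  assume "bounded (of_chart -` cell_of_type A t)"
  then obtain B where B: "\<And>q. of_chart q \<in> cell_of_type A t \<Longrightarrow> norm q \<le> B"
    unfolding bounded_iff by auto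
  obtain v where v: "v \<in> open_sector A t"
    using assms(2) by (auto simp: cell_of_type_eq)
  let ?w = "chart (axis k 1)"
  \<comment> \<open>\<open>?w\<close> is the direction of the \<open>k\<close>-th axis in the chart; \<open>s\<close> is large enough to leave the
    ball of radius \<open>B\<close>\<close>
  define s where "s = (B + norm (chart v) + 1) / norm ?w"
  have w: "norm ?w > 0"
    using chart_axis_nonzero by simp
  have "of_chart (chart v) \<in> cell_of_type A t"
    using v by (simp add: of_chart_chart cell_of_type_eq)
  then have "B \<ge> 0"
    using B norm_ge_zero order_trans by blast
  then have s: "s > 0"
    using w by (simp add: s_def add_nonneg_pos)
  let ?u = "v - s *\<^sub>R axis k 1"
  have "A $ i $ j + ?u $ j < A $ i $ t i + ?u $ t i" if "j \<noteq> t i" for i j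
  proof -
    have "t i \<noteq> k"
      using assms(1) by auto
    moreover have "A $ i $ j + v $ j < A $ i $ t i + v $ t i"
      using v that by (auto simp: open_sector_def)
    ultimately show ?thesis
      using s by (auto simp: axis_def)
  qed
  then have "?u \<in> open_sector A t"
    by (simp add: open_sector_def)
  then have "of_chart (chart ?u) \<in> cell_of_type A t"
    by (simp add: of_chart_chart cell_of_type_eq)
  then have "norm (chart ?u) \<le> B"
    by (rule B)
  moreover have "chart ?u = chart v - s *\<^sub>R ?w"
    by (simp add: linear_diff[OF linear_chart] linear_scale[OF linear_chart])
  moreover have "norm (s *\<^sub>R ?w) \<le> norm (chart v - s *\<^sub>R ?w) + norm (chart v)"
    by (metis norm_minus_commute norm_triangle_sub add.commute)
  moreover have "norm (s *\<^sub>R ?w) = B + norm (chart v) + 1"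
    using w \<open>B \<ge> 0\<close> by (simp add: s_def)
  ultimately show False
    by simp
qed

text \<open>At a point of a cell of type \<open>t\<close>, row \<open>j\<close> says that coordinate \<open>t j\<close> exceeds coordinate \<open>j\<close>
  whenever \<open>t j \<noteq> j\<close>. If \<open>t\<close> is a permutation other than the identity, summing over all \<open>j\<close>
  contradicts the invariance of the sum under \<open>t\<close>.\<close>

lemma surjective_type_is_identity:
  assumes diag: "\<And>i. A $ i $ i = 0" and nonpos: "\<And>i j. A $ i $ j \<le> 0"
    and "surj t" "cell_of_type A t \<noteq> {}"
  shows "t = (\<lambda>i. i)"
proof (rule ccontr)
  assume "t \<noteq> (\<lambda>i. i)"
  then obtain i where i: "t i \<noteq> i"
    by auto
  obtain v where v: "v \<in> open_sector A t"
    using assms(4) by (auto simp: cell_of_type_eq)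
  have less: "v $ j < v $ t j" if "t j \<noteq> j" for j
  proof -
    have "A $ j $ j + v $ j < A $ j $ t j + v $ t j"
      using v that by (auto simp: open_sector_def)
    then show ?thesis
      using diag[of j] nonpos[of j "t j"] by simp
  qed
  have "bij t"
    using \<open>surj t\<close> by (simp add: bij_def finite_UNIV_surj_inj)
  have "(\<Sum>j\<in>UNIV. v $ j) < (\<Sum>j\<in>UNIV. v $ t j)"
  proof (rule sum_strict_mono_ex1)
    show "\<forall>j\<in>UNIV. v $ j \<le> v $ t j"
      using less by (metis less_imp_le order_refl)
    show "\<exists>j\<in>UNIV. v $ j < v $ t j"
      using less i by blast
  qed simp
  also have "(\<Sum>j\<in>UNIV. v $ t j) = (\<Sum>j\<in>UNIV. v $ j)"
    using sum.reindex_bij_betw[OF \<open>bij t\<close>] by simp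
  finally show False
    by simp
qed

lemma bounded_cell_eq:
  assumes diag: "\<And>i. A $ i $ i = 0" and nonpos: "\<And>i j. A $ i $ j \<le> 0"
    and "bounded_cell A \<noteq> {}"
  shows "bounded_cell A = cell_of_type A (\<lambda>i. i)"
proof -
  have P: "P = cell_of_type A (\<lambda>i. i)" if "is_bounded_cell A P" for P
  proof -
    have "P \<in> range (cell_of_type A) - {{}}"
      using that by (simp add: is_bounded_cell_def two_cells_eq)
    then obtain t where t: "P = cell_of_type A t" "P \<noteq> {}"
      by blast
    moreover have "k \<in> range t" for k
      using unbounded_cell[of k t A] that t by (auto simp: is_bounded_cell_def)
    then have "surj t"
      by blast
    ultimately show ?thesis
      using surjective_type_is_identity[OF diag nonpos] by blast
  qed
  obtain P where "is_bounded_cell A P"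
    using assms(3) by (auto simp: bounded_cell_def split: if_splits)
  then have "is_bounded_cell A (bounded_cell A)"
    unfolding bounded_cell_def using P by (metis (mono_tags, lifting) theI)
  then show ?thesis
    by (rule P)
qed

text \<open>The closed cell of identity type consists of the points with \<open>A $ i $ j + x $ j \<le> x $ i\<close> for
  all \<open>i\<close> and \<open>j\<close>, which are the fixed points.\<close>

lemma closure_bounded_cell:
  assumes diag: "\<And>i. A $ i $ i = 0" and nonpos: "\<And>i j. A $ i $ j \<le> 0"
    and "bounded_cell A \<noteq> {}"
  shows "closure (bounded_cell A) = {p. trop_map A p = p}"
proof -
  have "p \<in> closure (bounded_cell A) \<longleftrightarrow> trop_map A p = p" for p
  proof -
    obtain x where x: "x \<in> trop_vecs" "p = abs_tp2 x"
      by (rule tp2_cases)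
    have "p \<in> closure (bounded_cell A) \<longleftrightarrow> (\<forall>i. i \<in> maximizers A i p)"
      using assms(3) closure_cell_of_type[of A "\<lambda>i. i"]
      unfolding bounded_cell_eq[OF assms] by simp
    then show ?thesis
      unfolding x(2) trop_map_fixed_iff[OF diag nonpos x(1)]
        trop_mult_fixed_iff_maximizers[OF diag x(1)] .
  qed
  then show ?thesis
    by blast
qed

section \<open>Peripheral cells\<close>

text \<open>Where row \<open>j\<close> attains its maximum at \<open>j\<close> for all \<open>j \<noteq> k\<close>, the zero diagonal makes the map keep
  these two coordinates; coordinate \<open>k\<close> of the image depends on them alone, because \<open>k\<close> does not
  occur in the type.\<close>

lemma peripheral_projection:
  assumes diag: "\<And>i. A $ i $ i = 0"
    and ne: "cell_of_type A t \<noteq> {}" and k: "k \<notin> range t"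
    and t: "\<And>j. j \<noteq> k \<Longrightarrow> t j = j"
  shows "parallel_projection_on (closure (cell_of_type A t)) k (trop_span A) (trop_map A)"
proof -
  let ?D = "closure (cell_of_type A t)"
  have img: "trop_mult A x $ i = ereal (A $ i $ t i) + x $ t i"
    if "x \<in> trop_vecs" "abs_tp2 x \<in> ?D" for x i
    using that by (simp add: closure_cell_of_type[OF ne] mem_maximizers_iff_trop_mult)
  have "trop_map A p \<in> trop_span A \<and> agree_off k p (trop_map A p)" if p: "p \<in> ?D" for p
  proof
    show "trop_map A p \<in> trop_span A"
      by (simp add: trop_span_eq_range)
    obtain x where x: "x \<in> trop_vecs" "p = abs_tp2 x"
      by (rule tp2_cases)
    have "x $ j = trop_mult A x $ j" if "j \<noteq> k" for j
      using img[OF x(1), of j] p t[OF that] by (simp add: x(2) diag flip: zero_ereal_def)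
    then show "agree_off k p (trop_map A p)"
      unfolding agree_off_def using x trop_map_abs[OF x(1)] trop_mult_in_trop_vecs[OF x(1)] by blast
  qed
  moreover have "trop_map A p = trop_map A q" if pq: "p \<in> ?D" "q \<in> ?D" "agree_off k p q" for p q
  proof -
    obtain x y where x: "x \<in> trop_vecs" "p = abs_tp2 x" and y: "y \<in> trop_vecs" "q = abs_tp2 y"
      and xy: "\<And>j. j \<noteq> k \<Longrightarrow> x $ j = y $ j"
      using pq(3) unfolding agree_off_def by blast
    have "t i \<noteq> k" for i
      using k by auto
    then have "trop_mult A x = trop_mult A y"
      using img x y xy pq(1,2) by (simp add: vec_eq_iff)
    then show ?thesis
      using x y by (simp add: trop_map_abs)
  qed
  ultimately show ?thesis
    unfolding parallel_projection_on_def by blast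
qed

text \<open>A peripheral cell is either of the kind treated above or some row \<open>m \<noteq> k\<close> attains its maximum
  at the third index \<open>l\<close>. Then row \<open>l\<close> does not attain it at \<open>m\<close>, since the entries are
  nonpositive, and the index \<open>m\<close> can only come from row \<open>k\<close>. The inequalities of rows \<open>m\<close> and \<open>k\<close>
  add up to a strict violation of the triangle inequality at the entry \<open>(k, l)\<close>. For the
  matrices \<open>matF\<close> this detects an antenna.\<close>

lemma peripheral_type_cases:
  assumes diag: "\<And>i. A $ i $ i = 0" and nonpos: "\<And>i j. A $ i $ j \<le> 0"
    and t: "range t = UNIV - {k}" and ne: "cell_of_type A t \<noteq> {}"
  obtains "\<And>j. j \<noteq> k \<Longrightarrow> t j = j"
  | l m where "k \<noteq> l" "k \<noteq> m" "l \<noteq> m" "t = (\<lambda>j. if j = k then m else l)"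
      "A $ k $ l < A $ k $ m + A $ m $ l"
proof (cases "\<forall>j. j \<noteq> k \<longrightarrow> t j = j")
  case True
  then show ?thesis
    using that(1) by blast
next
  case False
  then obtain m where m: "m \<noteq> k" "t m \<noteq> m"
    by blast
  define l where "l = t m"
  have tk: "t j \<noteq> k" for j
    using t by auto
  have dist: "k \<noteq> l" "k \<noteq> m" "l \<noteq> m"
    using m tk[of m] by (auto simp: l_def)
  have cases: "j = k \<or> j = l \<or> j = m" for j
    using forall_3_distinct[OF dist, of "\<lambda>j. j = k \<or> j = l \<or> j = m"] by blast
  obtain v where v: "\<And>i j. j \<noteq> t i \<Longrightarrow> A $ i $ j + v $ j < A $ i $ t i + v $ t i"
    using ne by (auto simp: cell_of_type_eq open_sector_def)
  have row_m: "v $ m < A $ m $ l + v $ l"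
    using v[of m m] m(2) by (simp add: diag l_def)
  have "t l = l"
  proof (rule ccontr)
    assume *: "t l \<noteq> l"
    then have "t l = m"
      using cases[of "t l"] tk by blast
    then have "v $ l < A $ l $ m + v $ m"
      using v[of l l] * by (simp add: diag)
    then show False
      using row_m nonpos[of m l] nonpos[of l m] by simp
  qed
  moreover have "t k = m"
  proof -
    obtain j where "t j = m"
      using t dist by (metis DiffI UNIV_I imageE singletonD)
    then show ?thesis
      using cases[of j] \<open>t l = l\<close> dist l_def by auto
  qed
  ultimately have "t = (\<lambda>j. if j = k then m else l)"
    using cases l_def by fastforce
  moreover have "A $ k $ l < A $ k $ m + A $ m $ l"
    using v[of l k] row_m dist by (simp add: \<open>t k = m\<close>)
  ultimately show ?thesis
    using that(2) dist by blast
qed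

section \<open>Antennas\<close>

text \<open>The local situation at an antenna in the entry \<open>(i, k)\<close>, where \<open>m\<close> is the third index. In
  column \<open>k\<close>, the matrices \<open>A\<close> and \<open>L\<close> differ only in row \<open>i\<close>, where \<open>L\<close> has the entry of
  \<open>A \<odot> A\<close>, which is reached through \<open>m\<close>. All four kinds of antennas satisfy these conditions, so
  that they are treated at once.\<close>

locale antenna_data =
  fixes A L :: "real ^ 3 ^ 3" and i k m :: 3
  assumes dist: "i \<noteq> k" "i \<noteq> m" "k \<noteq> m"
    and diag: "\<And>j. A $ j $ j = 0" and nonpos: "\<And>j l. A $ j $ l \<le> 0"
    and Lk: "L $ k $ k = 0" and Lm: "L $ m $ k = A $ m $ k"
    and Li: "L $ i $ k = A $ i $ m + A $ m $ k"
    and gap: "A $ i $ k < L $ i $ k"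
    and tri: "A $ m $ i + L $ i $ k \<le> A $ m $ k"
begin

text \<open>The type of the cell \<open>P\<^sub>a\<close>: row \<open>i\<close> attains its maximum at \<open>m\<close>, on the detour that makes
  \<open>A \<odot> A\<close> larger than \<open>A\<close>.\<close>

abbreviation antenna_type :: "3 \<Rightarrow> 3" where
  "antenna_type \<equiv> \<lambda>j. if j = i then m else k"

lemmas all_3 = forall_3_distinct[OF dist]

lemma dist': "k \<noteq> i" "m \<noteq> i" "m \<noteq> k"
  using dist by auto

lemma cell_nonempty: "cell_of_type A antenna_type \<noteq> {}"
proof -
  \<comment> \<open>Row \<open>m\<close> requires \<open>v $ m - v $ k < A $ m $ k\<close>, and row \<open>i\<close> requires this difference to exceed
    \<open>A $ i $ k - A $ i $ m\<close>, which is smaller by the length of the antenna; \<open>e\<close> picks the middle.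
    Coordinate \<open>i\<close> only has to be small.\<close>
  define e where "e = (L $ i $ k - A $ i $ k) / 2"
  have e: "e > 0" "A $ i $ k + e < L $ i $ k"
    using gap by (auto simp: e_def field_simps)
  define v :: "real ^ 3" where "v = (\<chi> j. if j = k then 0 else if j = m then A $ m $ k - e
      else A $ m $ k - e + A $ i $ m + A $ m $ k - 1)"
  have v: "v $ k = 0" "v $ m = A $ m $ k - e" "v $ i = A $ m $ k - e + A $ i $ m + A $ m $ k - 1"
    using dist by (auto simp: v_def)
  have "v \<in> open_sector A antenna_type"
    unfolding open_sector_def mem_Collect_eq all_3
    using dist dist' e Li gap nonpos[of m i] nonpos[of m k] nonpos[of i m] nonpos[of k m] nonpos[of k i]
    by (simp add: v diag)
  then show ?thesis
    by (auto simp: cell_of_type_eq)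
qed

lemmas closure_cell = closure_cell_of_type[OF cell_nonempty]

lemma real_point_in_closure_iff:
  "real_point v \<in> closure (cell_of_type A antenna_type) \<longleftrightarrow> v \<in> closed_sector A antenna_type"
  by (simp add: closure_cell mem_maximizers_real_point closed_sector_def)

lemma segment_ends_in_closed_sector:
  "column k L \<in> closed_sector A antenna_type"
  "column k A \<in> closed_sector A antenna_type"
  "column i (- transpose A) \<in> closed_sector A antenna_type"
  unfolding closed_sector_def mem_Collect_eq all_3
  using dist dist' Lk Lm Li gap tri nonpos[of m i] nonpos[of m k] nonpos[of i m] nonpos[of k m]
    nonpos[of k i] nonpos[of i k]
  by (simp_all add: diag column_def transpose_def)

lemma coantenna_eq:
  "coantenna L A i k = real_point ` closed_segment (column k L) (column i (- transpose A))"
  unfolding coantenna_def of_chart_segment ..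

lemma chart_ends_distinct: "chart (column k A) \<noteq> chart (column k L)"
proof
  assume "chart (column k A) = chart (column k L)"
  then have eq: "column k A $ j - column k L $ j = column k A $ 3 - column k L $ 3" for j
    using exhaust_3[of j] by (auto simp: chart_def)
  from eq[of k] eq[of i] show False
    using gap by (simp add: column_def diag Lk)
qed

lemma antenna_subset: "antenna L A k \<subseteq> real_point ` closed_segment (column k L) (column k A)"
  unfolding antenna_def of_chart_segment[symmetric] by blast

lemma in_antenna:
  assumes "0 < u" "u \<le> 1"
  shows "real_point ((1 - u) *\<^sub>R column k L + u *\<^sub>R column k A) \<in> antenna L A k"
proof -
  let ?a = "chart (column k L)" and ?b = "chart (column k A)"
  let ?w = "(1 - u) *\<^sub>R column k L + u *\<^sub>R column k A"
  have w: "chart ?w = (1 - u) *\<^sub>R ?a + u *\<^sub>R ?b"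
    by (simp add: linear_add[OF linear_chart] linear_scale[OF linear_chart])
  then have "chart ?w \<in> closed_segment ?a ?b"
    using assms by (auto simp: closed_segment_def)
  moreover have "chart ?w - ?a = u *\<^sub>R (?b - ?a)"
    unfolding w by (simp add: algebra_simps)
  then have "chart ?w \<noteq> ?a"
    using assms chart_ends_distinct by auto
  ultimately show ?thesis
    unfolding antenna_def by (metis DiffI imageI of_chart_chart singletonD)
qed

text \<open>Closed cells are convex, so it suffices that the ends of both segments satisfy the weak
  inequalities.\<close>

lemma antennas_subset_closure:
  "antenna L A k \<union> coantenna L A i k \<subseteq> closure (cell_of_type A antenna_type)"
proof -
  have "real_point ` closed_segment a b \<subseteq> closure (cell_of_type A antenna_type)"
    if "a \<in> closed_sector A antenna_type" "b \<in> closed_sector A antenna_type" for a b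
    using closed_segment_subset[OF that convex_closed_sector]
    by (auto simp: real_point_in_closure_iff)
  then show ?thesis
    using segment_ends_in_closed_sector antenna_subset unfolding coantenna_eq by blast
qed

text \<open>The outer ends of the two antennas determine the cell. At column \<open>k\<close> of \<open>A\<close>, row \<open>i\<close> attains
  its maximum at \<open>m\<close> only; at column \<open>i\<close> of \<open>- transpose A\<close>, rows \<open>k\<close> and \<open>m\<close> attain theirs at
  \<open>k\<close> only.\<close>

lemma antenna_type_unique:
  assumes "antenna L A k \<union> coantenna L A i k \<subseteq> closure (cell_of_type A t)"
    and ne: "cell_of_type A t \<noteq> {}"
  shows "t = antenna_type"
proof -
  have mem: "\<And>j l. A $ j $ l + v $ l \<le> A $ j $ t j + v $ t j"
    if "real_point v \<in> antenna L A k \<union> coantenna L A i k" for v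
    using that assms(1) by (auto simp: closure_cell_of_type[OF ne] mem_maximizers_real_point)
  have all: "j = i \<or> j = k \<or> j = m" for j
    using all_3[of "\<lambda>j. j = i \<or> j = k \<or> j = m"] by blast
  have "real_point (column k A) \<in> antenna L A k"
    using in_antenna[of 1] by simp
  then have a: "A $ j $ l + A $ l $ k \<le> A $ j $ t j + A $ t j $ k" for j l
    using mem[of "column k A"] by (simp add: column_def)
  have "t i = m"
    using a[of i m] all[of "t i"] gap Li by (auto simp: diag)
  have "real_point (column i (- transpose A)) \<in> coantenna L A i k"
    unfolding coantenna_eq by blast
  then have b: "A $ j $ l - A $ i $ l \<le> A $ j $ t j - A $ i $ t j" for j l
    using mem[of "column i (- transpose A)" j l] by (simp add: column_def transpose_def)
  have "t m = k"
    using b[of m k] all[of "t m"] gap Li nonpos[of m i] nonpos[of i m] by (auto simp: diag)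
  moreover have "t k = k"
    using b[of k k] all[of "t k"] gap Li nonpos[of k i] nonpos[of k m] nonpos[of m k] nonpos[of i m]
    by (auto simp: diag)
  ultimately show ?thesis
    using \<open>t i = m\<close> all by (auto simp: fun_eq_iff)
qed

lemma antenna_cell_eq: "antenna_cell L A i k = cell_of_type A antenna_type"
  unfolding antenna_cell_def
proof (rule the_equality)
  have "range antenna_type = {m, k}"
    using dist by auto
  also have "\<dots> = UNIV - {i}"
    using dist all_3[of "\<lambda>j. j = i \<or> j = k \<or> j = m"] by auto
  finally have "range antenna_type = UNIV - {i}" .
  moreover have "cell_of_type A antenna_type \<in> two_cells A"
    using cell_nonempty by (simp add: two_cells_eq)
  ultimately have "cell_of_type A antenna_type \<in> peripheral_cells A i"
    unfolding peripheral_cells_def by blast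
  then show "cell_of_type A antenna_type \<in> (\<Union>j. peripheral_cells A j) \<and>
      antenna L A k \<union> coantenna L A i k \<subseteq> closure (cell_of_type A antenna_type)"
    using antennas_subset_closure by blast
next
  fix P assume P: "P \<in> (\<Union>j. peripheral_cells A j) \<and>
      antenna L A k \<union> coantenna L A i k \<subseteq> closure P"
  then have "P \<in> range (cell_of_type A) - {{}}"
    unfolding peripheral_cells_def two_cells_eq by blast
  then obtain t where t: "P = cell_of_type A t" "P \<noteq> {}"
    by blast
  then have "t = antenna_type"
    using P by (intro antenna_type_unique) simp_all
  then show "P = cell_of_type A antenna_type"
    by (simp add: t(1))
qed

text \<open>Describing the segment by inequalities between homogeneous coordinates shows that it is closed,
  and makes images under the tropical map easy to locate in it. The inequalities exclude infinite
  coordinates: if coordinate \<open>k\<close> were \<open>- \<infinity>\<close>, all would be.\<close>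

lemma mem_segment_iff:
  assumes x: "x \<in> trop_vecs"
  shows "abs_tp2 x \<in> real_point ` closed_segment (column k L) (column k A) \<longleftrightarrow>
    x $ m = ereal (A $ m $ k) + x $ k \<and>
    ereal (A $ i $ k) + x $ k \<le> x $ i \<and> x $ i \<le> ereal (L $ i $ k) + x $ k" (is "_ \<longleftrightarrow> ?r")
proof
  assume "abs_tp2 x \<in> real_point ` closed_segment (column k L) (column k A)"
  then obtain u where u: "0 \<le> u" "u \<le> 1"
    and "abs_tp2 x = real_point ((1 - u) *\<^sub>R column k L + u *\<^sub>R column k A)"
    by (auto simp: closed_segment_def)
  then obtain c :: real where
    "\<And>j. x $ j = ereal c + ereal_vec ((1 - u) *\<^sub>R column k L + u *\<^sub>R column k A) $ j"
    unfolding real_point_eq_abs abs_tp2_eq_iff[OF x ereal_vec_in_trop_vecs] by blast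
  then have c: "x $ j = ereal (c + ((1 - u) * L $ j $ k + u * A $ j $ k))" for j
    by (simp add: column_def)
  have "u * (L $ i $ k - A $ i $ k) \<ge> 0" "(1 - u) * (L $ i $ k - A $ i $ k) \<ge> 0"
    using u gap by auto
  then show ?r
    unfolding c by (simp add: Lk Lm diag algebra_simps)
next
  assume r: ?r
  have "x $ k \<noteq> - \<infinity>"
  proof
    assume k: "x $ k = - \<infinity>"
    with r have "\<forall>j. x $ j = - \<infinity>"
      unfolding all_3 by simp
    with x show False
      by (simp add: trop_vecs_def)
  qed
  then obtain c where c: "x $ k = ereal c"
    using trop_vecs_not_PInf[OF x, of k] by (cases "x $ k") auto
  have "\<forall>j. x $ j \<noteq> - \<infinity>"
    unfolding all_3 using r c by auto
  then obtain v where v: "x = ereal_vec v"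
    using ereal_vec_exhaust[OF x] by blast
  define h where "h = L $ i $ k - A $ i $ k"
  \<comment> \<open>the position on the segment: the portion of the antenna length \<open>h\<close> by which coordinate \<open>i\<close>,
    relative to coordinate \<open>k\<close>, has dropped below its value on column \<open>k\<close> of \<open>L\<close>\<close>
  define u where "u = (L $ i $ k + v $ k - v $ i) / h"
  have h: "h > 0"
    using gap by (simp add: h_def)
  have r: "v $ m = A $ m $ k + v $ k" "A $ i $ k + v $ k \<le> v $ i" "v $ i \<le> L $ i $ k + v $ k"
    using r by (simp_all add: v)
  have u: "0 \<le> u" "u \<le> 1"
    using h r by (simp_all add: u_def h_def)
  have "u * h = L $ i $ k + v $ k - v $ i"
    using h by (simp add: u_def)
  then have "\<forall>j. v $ j = v $ k + ((1 - u) *\<^sub>R column k L + u *\<^sub>R column k A) $ j"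
    unfolding all_3 using r by (simp add: column_def Lk Lm diag h_def algebra_simps)
  then have "real_point v = real_point ((1 - u) *\<^sub>R column k L + u *\<^sub>R column k A)"
    by (intro real_point_shift[of _ "v $ k"]) blast
  moreover have "(1 - u) *\<^sub>R column k L + u *\<^sub>R column k A \<in> closed_segment (column k L) (column k A)"
    using u by (auto simp: closed_segment_def)
  ultimately show "abs_tp2 x \<in> real_point ` closed_segment (column k L) (column k A)"
    unfolding v real_point_eq_abs[symmetric] by blast
qed

lemma closure_antenna:
  "closure (antenna L A k) = real_point ` closed_segment (column k L) (column k A)" (is "_ = ?S")
proof
  have "closed ?S"
  proof (rule closed_tp2I)
    let ?le = "\<lambda>a j b l. {x::ereal^3. ereal a + x $ j \<le> ereal b + x $ l}"
    show "closed (?le 0 m (A $ m $ k) k \<inter> ?le (A $ m $ k) k 0 m \<inter>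
        ?le (A $ i $ k) k 0 i \<inter> ?le 0 i (L $ i $ k) k)"
      by (intro closed_Int closed_shifted_le)
  qed (auto simp: mem_segment_iff simp flip: zero_ereal_def)
  then show "closure (antenna L A k) \<subseteq> ?S"
    by (rule closure_minimal[OF antenna_subset])
  show "?S \<subseteq> closure (antenna L A k)"
  proof
    fix p assume "p \<in> ?S"
    then obtain u where u: "0 \<le> u" "u \<le> 1"
      and p: "p = real_point ((1 - u) *\<^sub>R column k L + u *\<^sub>R column k A)"
      by (auto simp: closed_segment_def)
    show "p \<in> closure (antenna L A k)"
    proof (cases "u = 0")
      case False
      with u show ?thesis
        unfolding p by (intro subsetD[OF closure_subset] in_antenna) auto
    next
      case True
      let ?c = "\<lambda>n. inverse (real (Suc n))"
      let ?w = "\<lambda>n. (1 - ?c n) *\<^sub>R column k L + ?c n *\<^sub>R column k A"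
      have "?w \<longlonglongrightarrow> (1 - 0) *\<^sub>R column k L + 0 *\<^sub>R column k A"
        by (intro tendsto_intros LIMSEQ_inverse_real_of_nat)
      then have "(\<lambda>n. real_point (?w n)) \<longlonglongrightarrow> p"
        unfolding p True
        by (rule continuous_on_tendsto_compose[OF continuous_on_real_point]) simp_all
      then show ?thesis
        by (rule in_closure_limit) (simp_all add: in_antenna inverse_le_1_iff)
    qed
  qed
qed

text \<open>On \<open>P\<^sub>a\<close> the map sends \<open>x\<close> to the point with coordinates \<open>x $ k\<close>, \<open>A $ m $ k + x $ k\<close> and
  \<open>A $ i $ m + x $ m\<close> at \<open>k\<close>, \<open>m\<close> and \<open>i\<close>. The difference of the first two is as in column \<open>k\<close>, and
  the inequalities of rows \<open>m\<close> and \<open>i\<close> bound the third exactly by the ends of the antenna.\<close>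

lemma antenna_cell_image:
  "trop_map A ` closure (antenna_cell L A i k) = closure (antenna L A k)"
  unfolding antenna_cell_eq closure_antenna
proof (intro equalityI subsetI)
  fix q assume "q \<in> trop_map A ` closure (cell_of_type A antenna_type)"
  then obtain p where p: "p \<in> closure (cell_of_type A antenna_type)" "q = trop_map A p"
    by blast
  obtain x where x: "x \<in> trop_vecs" "p = abs_tp2 x"
    by (rule tp2_cases)
  have max: "antenna_type j \<in> maximizers A j (abs_tp2 x)" for j
    using p(1) unfolding closure_cell x(2) by blast
  have img: "trop_mult A x $ i = ereal (A $ i $ m) + x $ m" "trop_mult A x $ k = x $ k"
    "trop_mult A x $ m = ereal (A $ m $ k) + x $ k"
    using max[of i] max[of k] max[of m] dist dist'
    by (simp_all add: mem_maximizers_iff_trop_mult[OF x(1)] diag flip: zero_ereal_def)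
  have "ereal (A $ i $ k) + x $ k \<le> ereal (A $ i $ m) + x $ m"
    using trop_mult_nth_ge[of A i k x] img(1) by simp
  moreover have "x $ m \<le> ereal (A $ m $ k) + x $ k"
    using trop_mult_nth_ge[of A m m x] img(3) by (simp add: diag flip: zero_ereal_def)
  then have "ereal (A $ i $ m) + x $ m \<le> ereal (A $ i $ m) + (ereal (A $ m $ k) + x $ k)"
    by (rule add_left_mono)
  then have "ereal (A $ i $ m) + x $ m \<le> ereal (L $ i $ k) + x $ k"
    by (simp add: Li add.assoc flip: plus_ereal.simps)
  ultimately show "q \<in> real_point ` closed_segment (column k L) (column k A)"
    unfolding p(2) x(2) trop_map_abs[OF x(1)] mem_segment_iff[OF trop_mult_in_trop_vecs[OF x(1)]] img
    by simp
next
  fix q assume "q \<in> real_point ` closed_segment (column k L) (column k A)"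
  then obtain w where w: "q = real_point w" "w \<in> closed_segment (column k L) (column k A)"
    by blast
  then have "abs_tp2 (ereal_vec w) \<in> real_point ` closed_segment (column k L) (column k A)"
    unfolding real_point_eq_abs[symmetric] by blast
  then have w': "w $ m = A $ m $ k + w $ k" "A $ i $ k + w $ k \<le> w $ i" "w $ i \<le> L $ i $ k + w $ k"
    using mem_segment_iff[of "ereal_vec w"] by simp_all
  \<comment> \<open>the preimage in the closed cell that differs from \<open>w\<close> in coordinate \<open>m\<close> only, which
    \<open>A $ i $ m\<close> then carries to \<open>w $ i\<close>\<close>
  define v :: "real ^ 3" where "v = (\<chi> j. if j = m then w $ i - A $ i $ m else w $ j)"
  have v: "v $ i = w $ i" "v $ k = w $ k" "v $ m = w $ i - A $ i $ m"
    using dist by (auto simp: v_def)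
  have "v \<in> closed_sector A antenna_type"
    unfolding closed_sector_def mem_Collect_eq all_3
    using dist dist' w' Li tri nonpos[of m i] nonpos[of m k] nonpos[of i m] nonpos[of k m]
      nonpos[of k i] nonpos[of i k]
    by (simp add: v diag)
  then have cl: "real_point v \<in> closure (cell_of_type A antenna_type)"
    by (simp add: real_point_in_closure_iff)
  then have "antenna_type j \<in> maximizers A j (abs_tp2 (ereal_vec v))" for j
    unfolding closure_cell real_point_eq_abs by blast
  then have "trop_mult A (ereal_vec v) $ j = ereal (A $ j $ antenna_type j + v $ antenna_type j)" for j
    by (simp add: mem_maximizers_iff_trop_mult)
  moreover have "\<forall>j. A $ j $ antenna_type j + v $ antenna_type j = w $ j"
    unfolding all_3 using dist dist' w' by (simp add: v diag)
  ultimately have "trop_mult A (ereal_vec v) = ereal_vec w"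
    by (simp add: vec_eq_iff)
  then have "trop_map A (real_point v) = q"
    by (simp add: w(1) real_point_eq_abs trop_map_abs)
  then show "q \<in> trop_map A ` closure (cell_of_type A antenna_type)"
    using cl by blast
qed

end

section \<open>The canonical matrices\<close>

lemma matF_nth:
  "matF d d1 d2 d3 h1 h2 h3 g $ 1 $ 1 = 0"
  "matF d d1 d2 d3 h1 h2 h3 g $ 1 $ 2 = - d - d2"
  "matF d d1 d2 d3 h1 h2 h3 g $ 1 $ 3 = - 2 * d - d3 - h3"
  "matF d d1 d2 d3 h1 h2 h3 g $ 2 $ 1 = - 2 * d - d1 - h1"
  "matF d d1 d2 d3 h1 h2 h3 g $ 2 $ 2 = 0"
  "matF d d1 d2 d3 h1 h2 h3 g $ 2 $ 3 = - d - d3 - g"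
  "matF d d1 d2 d3 h1 h2 h3 g $ 3 $ 1 = - d - d1"
  "matF d d1 d2 d3 h1 h2 h3 g $ 3 $ 2 = - 2 * d - d2 - h2"
  "matF d d1 d2 d3 h1 h2 h3 g $ 3 $ 3 = 0"
  by (simp_all add: matF_def vector_3)

lemma matL_eq_matF: "matL d d1 d2 d3 = matF d d1 d2 d3 0 0 0 0"
  by (simp add: matL_def matF_def)

theorem theorem3:
  fixes d d1 d2 d3 h1 h2 h3 g :: real and A L :: "real ^ 3 ^ 3"
  assumes nonneg: "d \<ge> 0" "d1 \<ge> 0" "d2 \<ge> 0" "d3 \<ge> 0" "h1 \<ge> 0" "h2 \<ge> 0" "h3 \<ge> 0" "g \<ge> 0"
    and condition1: "h2 > 0 \<Longrightarrow> d1 = 0" "h3 > 0 \<Longrightarrow> d2 = 0" "h1 > 0 \<Longrightarrow> d3 = 0"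
    and condition2: "g > 0 \<Longrightarrow> d = 0 \<and> d1 = 0 \<and> h3 = 0"
    and overlap: "g > 0 \<Longrightarrow> h1 = 0"
    and A: "A = matF d d1 d2 d3 h1 h2 h3 g"
    and L: "L = matL d d1 d2 d3"
  shows "(\<forall>C\<in>corners A. \<exists>k. trop_map A ` closure C = {real_point (column k A)})
    \<and> (\<forall>(i, k)\<in>antenna_entries h1 h2 h3 g.
          trop_map A ` closure (antenna_cell L A i k) = closure (antenna L A k))
    \<and> (\<forall>k. \<forall>P\<in>peripheral_cells A k.
          (\<forall>(i, j)\<in>antenna_entries h1 h2 h3 g. P \<noteq> antenna_cell L A i j) \<longrightarrow>
          parallel_projection_on (closure P) k (trop_span A) (trop_map A))
    \<and> soma d d1 d2 d3 = {p. trop_map A p = p}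
    \<and> (bounded_cell A \<noteq> {} \<longrightarrow> soma d d1 d2 d3 = closure (bounded_cell A))"
proof -
  have L': "L = matF d d1 d2 d3 0 0 0 0"
    by (simp add: L matL_eq_matF)
  have diag: "A $ i $ i = 0" for i
    using exhaust_3[of i] by (auto simp: A matF_nth)
  have nonpos: "A $ i $ j \<le> 0" for i j
    using exhaust_3[of i] exhaust_3[of j] nonneg by (auto simp: A matF_nth)
  have g_cases: "g = 0 \<or> d = 0 \<and> d1 = 0 \<and> h1 = 0 \<and> h3 = 0"
    using nonneg condition2 overlap by fastforce
  \<comment> \<open>the conditions on the parameters ensure that the detour through \<open>m\<close> has the weight of the
    entry \<open>(i, k)\<close> of \<open>L\<close>\<close>
  have antenna: "antenna_data A L i k m"
    if "(i, k) \<in> antenna_entries h1 h2 h3 g" "m \<noteq> i" "m \<noteq> k" for i k m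
    using that nonneg condition1 g_cases exhaust_3[of m] diag nonpos
    by unfold_locales (auto simp: antenna_entries_def A L' matF_nth)
  have fixed: "soma d d1 d2 d3 = {p. trop_map A p = p}"
    unfolding soma_def L[symmetric]
  proof (rule trop_span_eq_fixed_points[OF diag nonpos])
    show "L $ i $ i = 0" for i
      using exhaust_3[of i] by (auto simp: L' matF_nth)
    show "A $ i $ j + L $ j $ k \<le> L $ i $ k" for i j k
      using exhaust_3[of i] exhaust_3[of j] exhaust_3[of k] nonneg by (auto simp: A L' matF_nth)
    \<comment> \<open>\<open>L \<le> A \<odot> A\<close>: at an antenna entry by the detour through the third index, elsewhere by the
      zero diagonal\<close>
    show "\<exists>j. L $ i $ k \<le> A $ i $ j + A $ j $ k" for i k
    proof (cases "(i, k) \<in> antenna_entries h1 h2 h3 g")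
      case True
      obtain m where "m \<noteq> i" "m \<noteq> k"
        by (rule third_index)
      then have "L $ i $ k = A $ i $ m + A $ m $ k"
        by (rule antenna_data.Li[OF antenna[OF True]])
      then show ?thesis
        by (intro exI[of _ m]) simp
    next
      case False
      then have "L $ i $ k \<le> A $ i $ k"
        using exhaust_3[of i] exhaust_3[of k] nonneg
        by (auto simp: antenna_entries_def A L' matF_nth)
      then show ?thesis
        by (intro exI[of _ i]) (simp add: diag)
    qed
  qed
  \<comment> \<open>conversely, the triangle inequality of \<open>A\<close> fails at antenna entries only\<close>
  have entry: "(i, k) \<in> antenna_entries h1 h2 h3 g"
    if "i \<noteq> k" "i \<noteq> m" "k \<noteq> m" "A $ i $ k < A $ i $ m + A $ m $ k" for i k m
    using that nonneg exhaust_3[of i] exhaust_3[of k] exhaust_3[of m]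
    by (auto simp: antenna_entries_def A matF_nth)
  have part2: "trop_map A ` closure (antenna_cell L A i k) = closure (antenna L A k)"
    if "(i, k) \<in> antenna_entries h1 h2 h3 g" for i k
  proof -
    obtain m where "m \<noteq> i" "m \<noteq> k"
      by (rule third_index)
    then have "antenna_data A L i k m"
      by (rule antenna[OF that])
    then show ?thesis
      by (rule antenna_data.antenna_cell_image)
  qed
  have part3: "parallel_projection_on (closure P) k (trop_span A) (trop_map A)"
    if P: "P \<in> peripheral_cells A k"
      and not: "\<And>i j. (i, j) \<in> antenna_entries h1 h2 h3 g \<Longrightarrow> P \<noteq> antenna_cell L A i j" for P k
  proof -
    have "P \<noteq> {}"
      using P by (simp add: peripheral_cells_def two_cells_eq)
    with P obtain t where t: "P = cell_of_type A t" "range t = UNIV - {k}" "cell_of_type A t \<noteq> {}"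
      unfolding peripheral_cells_def by blast
    show ?thesis
    proof (rule peripheral_type_cases[OF diag nonpos t(2,3)])
      assume "\<And>j. j \<noteq> k \<Longrightarrow> t j = j"
      moreover have "k \<notin> range t"
        by (simp add: t(2))
      ultimately show ?thesis
        unfolding t(1) by (intro peripheral_projection diag t(3))
    next
      fix l m
      assume *: "k \<noteq> l" "k \<noteq> m" "l \<noteq> m" "t = (\<lambda>j. if j = k then m else l)"
        "A $ k $ l < A $ k $ m + A $ m $ l"
      have e: "(k, l) \<in> antenna_entries h1 h2 h3 g"
        by (rule entry[OF *(1,2,3,5)])
      have "antenna_data A L k l m"
        using *(2,3) by (intro antenna[OF e]) simp_all
      then have "antenna_cell L A k l = P"
        unfolding t(1) *(4) by (rule antenna_data.antenna_cell_eq)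
      with not[OF e] show ?thesis
        by simp
    qed
  qed
  have part5: "soma d d1 d2 d3 = closure (bounded_cell A)" if "bounded_cell A \<noteq> {}"
    unfolding fixed closure_bounded_cell[OF diag nonpos that] ..
  show ?thesis
  proof (intro conjI ballI allI impI)
    show "\<exists>k. trop_map A ` closure C = {real_point (column k A)}" if "C \<in> corners A" for C
      using that by (rule corner_collapses)
    show "case e of (i, k) \<Rightarrow>
        trop_map A ` closure (antenna_cell L A i k) = closure (antenna L A k)"
      if "e \<in> antenna_entries h1 h2 h3 g" for e
      using that part2 by (cases e) simp
    show "parallel_projection_on (closure P) k (trop_span A) (trop_map A)"
      if P: "P \<in> peripheral_cells A k"
        and not: "\<forall>(i, j)\<in>antenna_entries h1 h2 h3 g. P \<noteq> antenna_cell L A i j" for k P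
    proof (rule part3[OF P])
      show "P \<noteq> antenna_cell L A i j" if "(i, j) \<in> antenna_entries h1 h2 h3 g" for i j
        using bspec[OF not that] by simp
    qed
    show "soma d d1 d2 d3 = {p. trop_map A p = p}"
      by (rule fixed)
    show "soma d d1 d2 d3 = closure (bounded_cell A)" if "bounded_cell A \<noteq> {}"
      using that by (rule part5)
  qed
qed

end
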